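(* Let $\mathcal{K}$ be an ordered simplicial complex, i.e. a simplicial complex over a totally ordered set $S$ of vertices. Then $L(S\mathcal{K})$ and $\mathbb{L}(M\mathcal{K})$ are homeomorphic, and the spaces $L(S\mathcal{K})$, $L(\mathcal{K})$ and $|\mathcal{K}|$ are homotopy equivalent.
   Context: $(\Omega,\lambda)$ is a fixed atomless complete probability space. A simplicial complex $\mathcal{K}$ over $S$ is a collection of non-empty finite subsets of $S$ closed under taking non-empty subsets; $|\mathcal{K}|$ is its usual geometric realization (the set of probability measures on $S$ whose support belongs to $\mathcal{K}$, with the weak topology, i.e. the topology determined by the closed simplices). $L(\mathcal{K})$ is the metric space of measurable maps $f:\Omega\to S$ (modulo almost everywhere equality) whose essential image $f(\Omega) = \{s\in S : \lambda(f^{-1}(s))>0\}$ belongs to $\mathcal{K}$, with metric $d(f,g) = \int_\Omega d(f(t),g(t))\,\mathrm{d}\lambda(t)$, $S$ carrying the discrete metric $d(x,y)=1-\delta_{x,y}$. $[n]=\{0,\dots,n\}$; $\mathbf{\Delta}$ is the category of the $[n]$, $n\ge 0$, and weakly increasing maps, $\mathbf{M}$ its subcategory with the same objects and the injective maps. For a simplicial set $F:\mathbf{\Delta}^{op}\to\mathbf{Set}$ (resp. a pre-simplicial set $F:\mathbf{M}^{op}\to\mathbf{Set}$), write $F_n=F([n])$ and $\alpha\sigma=F(\sigma)(\alpha)$. $S\mathcal{K}$ is the simplicial set with $S\mathcal{K}_n = \{(s_0,\dots,s_n)\in S^{n+1} : s_0\le\dots\le s_n,\ \{s_0,\dots,s_n\}\in\mathcal{K}\}$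 and, for $f:[m]\to[n]$ in $\mathbf{\Delta}$, $S\mathcal{K}(f)(s_0,\dots,s_n) = (s_{f(0)},\dots,s_{f(m)})$. $M\mathcal{K}$ is the associated pre-simplicial set, namely the restriction of $S\mathcal{K}$ to the category $\mathbf{M}$. $\nabla_n = L^1(\Omega,[n])$ is the set of measurable maps $\Omega\to[n]$ modulo almost everywhere equality, with metric $d(f,g)=\lambda(\{t:f(t)\ne g(t)\})$, and for $\sigma:[n]\to[m]$ in $\mathbf{\Delta}$, $\nabla(\sigma):\nabla_n\to\nabla_m$ is $f\mapsto\sigma\circ f$. For a simplicial set $F$, $L(F)$ is the quotient space of $\bigsqcup_n F_n\times\nabla_n$ ($F_n$ discrete) by the equivalence relation generated by $(\alpha\sigma,a)\sim(\alpha,\nabla(\sigma)(a))$ for $\sigma$ in $\mathbf{\Delta}$. For a pre-simplicial set $F$, $\mathbb{L}(F)$ is the quotient space of $\bigsqcup_n F_n\times\nabla_n$ by the equivalence relation generated by the same relations for $\sigma$ in $\mathbf{M}$ only.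
   Formalization: MK is taken to consist of the strictly increasing tuples only: with the plain restriction of SK to M (degenerate tuples kept) the homeomorphism fails already for a single vertex. Measurable maps into S are required to take almost all values in a countable set, so that the metric is defined. *)

theory Defs
  imports "HOL-Probability.Probability"
begin

section \<open>Probability spaces and random variables with values in a discrete set\<close>

definition atomless :: "'w measure \<Rightarrow> bool" where
  "atomless M \<longleftrightarrow>
    (\<forall>A\<in>sets M. 0 < measure M A \<longrightarrow>
      (\<exists>B\<in>sets M. B \<subseteq> A \<and> 0 < measure M B \<and> measure M B < measure M A))"

text \<open>
  Measurability of a map into the discrete metric space \<open>S\<close> is strong measurability: measurable for
  the discrete sigma-algebra and almost everywhere in a countable set. The second condition is
  vacuous when \<open>S\<close> is countable, in particular for maps into \<open>{..n}\<close>. For uncountable \<open>S\<close> it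
  is what makes \<open>{t. f t \<noteq> g t}\<close> measurable, hence the \<open>L\<^sup>1\<close> distance meaningful; without it one
  would have to exclude real-valued measurable cardinals.
\<close>
definition random_vars :: "'w measure \<Rightarrow> 's set \<Rightarrow> ('w \<Rightarrow> 's) set" where
  "random_vars M S =
    {f \<in> measurable M (count_space S). \<exists>C. countable C \<and> (AE t in M. f t \<in> C)}"

definition ae_class :: "'w measure \<Rightarrow> 's set \<Rightarrow> ('w \<Rightarrow> 's) \<Rightarrow> ('w \<Rightarrow> 's) set" where
  "ae_class M S f = {g \<in> random_vars M S. AE t in M. f t = g t}"

definition Lone :: "'w measure \<Rightarrow> 's set \<Rightarrow> ('w \<Rightarrow> 's) set set" where
  "Lone M S = ae_class M S ` random_vars M S"

definition discrete_dist :: "'s \<Rightarrow> 's \<Rightarrow> real" where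
  "discrete_dist x y = (if x = y then 0 else 1)"

definition rv_rep :: "('w \<Rightarrow> 's) set \<Rightarrow> 'w \<Rightarrow> 's" where
  "rv_rep F = (SOME f. f \<in> F)"

definition Lone_dist :: "'w measure \<Rightarrow> ('w \<Rightarrow> 's) set \<Rightarrow> ('w \<Rightarrow> 's) set \<Rightarrow> real" where
  "Lone_dist M F G = (\<integral>t. discrete_dist (rv_rep F t) (rv_rep G t) \<partial>M)"

definition essential_image :: "'w measure \<Rightarrow> ('w \<Rightarrow> 's) \<Rightarrow> 's set" where
  "essential_image M f = {s. 0 < measure M (f -` {s} \<inter> space M)}"

definition Lone_map :: "'w measure \<Rightarrow> 's set \<Rightarrow> ('r \<Rightarrow> 's) \<Rightarrow> ('w \<Rightarrow> 'r) set \<Rightarrow> ('w \<Rightarrow> 's) set" where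
  "Lone_map M S h F = ae_class M S (h \<circ> rv_rep F)"

lemma random_vars_countable:
  assumes "countable S"
  shows "random_vars M S = measurable M (count_space S)"
proof -
  have "AE t in M. f t \<in> S" if "f \<in> measurable M (count_space S)" for f
    using measurable_space[OF that] by (intro AE_I2) simp
  then show ?thesis using assms unfolding random_vars_def by blast
qed

lemma ae_class_eq_iff:
  assumes "f \<in> random_vars M S" "g \<in> random_vars M S"
  shows "ae_class M S f = ae_class M S g \<longleftrightarrow> (AE t in M. f t = g t)"
proof
  assume "ae_class M S f = ae_class M S g"
  moreover have "g \<in> ae_class M S g" using assms by (auto simp: ae_class_def)
  ultimately show "AE t in M. f t = g t" by (auto simp: ae_class_def)
next
  assume ae: "AE t in M. f t = g t"
  have "(AE t in M. f t = h t) \<longleftrightarrow> (AE t in M. g t = h t)" for h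
  proof
    show "AE t in M. g t = h t" if "AE t in M. f t = h t" using ae that by eventually_elim simp
    show "AE t in M. f t = h t" if "AE t in M. g t = h t" using ae that by eventually_elim simp
  qed
  then show "ae_class M S f = ae_class M S g" by (auto simp: ae_class_def)
qed

lemma rv_rep_in:
  assumes "F \<in> Lone M S"
  shows "rv_rep F \<in> random_vars M S" "ae_class M S (rv_rep F) = F"
proof -
  obtain f where f: "f \<in> random_vars M S" "F = ae_class M S f"
    using assms by (auto simp: Lone_def)
  then have "f \<in> F" by (auto simp: ae_class_def)
  then have "rv_rep F \<in> F" unfolding rv_rep_def by (rule someI[where P = "\<lambda>f. f \<in> F"])
  then have *: "rv_rep F \<in> random_vars M S" "AE t in M. f t = rv_rep F t"
    using f by (auto simp: ae_class_def)
  then show "rv_rep F \<in> random_vars M S" by simp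
  show "ae_class M S (rv_rep F) = F"
    using ae_class_eq_iff[OF f(1) *(1)] *(2) f(2) by simp
qed

lemma rv_rep_ae_class:
  assumes "f \<in> random_vars M S"
  shows "AE t in M. rv_rep (ae_class M S f) t = f t"
proof -
  have F: "ae_class M S f \<in> Lone M S" using assms by (auto simp: Lone_def)
  show ?thesis
    using ae_class_eq_iff[OF rv_rep_in(1)[OF F] assms] rv_rep_in(2)[OF F] by simp
qed

lemma discrete_dist_indicator:
  "(\<integral>t. discrete_dist (f t) (g t) \<partial>M) = measure M {t \<in> space M. f t \<noteq> g t}"
proof -
  have "(\<lambda>t. discrete_dist (f t) (g t)) = indicator {t. f t \<noteq> g t}"
    by (auto simp: fun_eq_iff discrete_dist_def)
  then have "(\<integral>t. discrete_dist (f t) (g t) \<partial>M) = measure M ({t. f t \<noteq> g t} \<inter> space M)"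
    by simp
  also have "{t. f t \<noteq> g t} \<inter> space M = {t \<in> space M. f t \<noteq> g t}" by auto
  finally show ?thesis .
qed

lemma Lone_dist_eq_measure:
  "Lone_dist M F G = measure M {t \<in> space M. rv_rep F t \<noteq> rv_rep G t}"
  by (simp add: Lone_dist_def discrete_dist_indicator)

lemma sets_neq_random_vars:
  assumes M: "complete_measure M" and f: "f \<in> random_vars M S" and g: "g \<in> random_vars M S"
  shows "{t \<in> space M. f t \<noteq> g t} \<in> sets M"
proof -
  interpret complete_measure M by fact
  obtain C where C: "countable C" "AE t in M. f t \<in> C"
    using f by (auto simp: random_vars_def)
  have meas: "f -` {c} \<inter> space M \<in> sets M" "g -` {c} \<inter> space M \<in> sets M" for c
  proof -
    have *: "h -` {c} \<inter> space M \<in> sets M" if h: "h \<in> measurable M (count_space S)" for h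
    proof (cases "c \<in> S")
      case True then show ?thesis using measurable_sets[OF h, of "{c}"] by simp
    next
      case False
      then have "h -` {c} \<inter> space M = {}" using measurable_space[OF h] by auto
      then show ?thesis by simp
    qed
    show "f -` {c} \<inter> space M \<in> sets M" "g -` {c} \<inter> space M \<in> sets M"
      using f g by (auto simp: random_vars_def intro!: *)
  qed
  let ?E = "\<Union>c\<in>C. (f -` {c} \<inter> space M) \<inter> (g -` {c} \<inter> space M)"
  have E: "?E \<in> sets M" using C(1) meas by (intro sets.countable_UN') auto
  obtain N where N: "{t \<in> space M. \<not> f t \<in> C} \<subseteq> N" "N \<in> null_sets M"
    using C(2) by (auto elim!: AE_E simp: null_sets_def)
  have "{t \<in> space M. f t = g t} - ?E \<subseteq> N" using N(1) by auto
  then have "{t \<in> space M. f t = g t} - ?E \<in> sets M" using N(2) by (rule complete)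
  then have "?E \<union> ({t \<in> space M. f t = g t} - ?E) \<in> sets M" using E by blast
  also have "?E \<union> ({t \<in> space M. f t = g t} - ?E) = {t \<in> space M. f t = g t}" by auto
  finally have "space M - {t \<in> space M. f t = g t} \<in> sets M" by blast
  also have "space M - {t \<in> space M. f t = g t} = {t \<in> space M. f t \<noteq> g t}" by auto
  finally show ?thesis .
qed

lemma Metric_space_Lone:
  fixes M :: "'w measure" and S :: "'s set"
  assumes P: "prob_space M" and M: "complete_measure M"
  shows "Metric_space (Lone M S) (Lone_dist M)"
proof
  interpret prob_space M by fact
  fix F G H :: "('w \<Rightarrow> 's) set"
  show "0 \<le> Lone_dist M F G" by (simp add: Lone_dist_eq_measure)
  show "Lone_dist M F G = Lone_dist M G F" by (simp add: Lone_dist_eq_measure eq_commute)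
  assume F: "F \<in> Lone M S" and G: "G \<in> Lone M S"
  note meas = sets_neq_random_vars[OF M rv_rep_in(1) rv_rep_in(1)]
  have "Lone_dist M F G = 0 \<longleftrightarrow> (AE t in M. rv_rep F t = rv_rep G t)"
    unfolding Lone_dist_eq_measure using meas[OF F G]
    by (subst prob_eq_0) auto
  also have "\<dots> \<longleftrightarrow> F = G"
    using ae_class_eq_iff[OF rv_rep_in(1)[OF F] rv_rep_in(1)[OF G]] rv_rep_in(2)[OF F] rv_rep_in(2)[OF G]
    by simp
  finally show "Lone_dist M F G = 0 \<longleftrightarrow> F = G" .
  assume H: "H \<in> Lone M S"
  have "measure M {t \<in> space M. rv_rep F t \<noteq> rv_rep H t} \<le>
      measure M ({t \<in> space M. rv_rep F t \<noteq> rv_rep G t} \<union> {t \<in> space M. rv_rep G t \<noteq> rv_rep H t})"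
    using meas[OF F G] meas[OF G H] by (intro finite_measure_mono) auto
  also have "\<dots> \<le> measure M {t \<in> space M. rv_rep F t \<noteq> rv_rep G t} +
      measure M {t \<in> space M. rv_rep G t \<noteq> rv_rep H t}"
    using meas[OF F G] meas[OF G H] by (rule measure_Un_le)
  finally show "Lone_dist M F H \<le> Lone_dist M F G + Lone_dist M G H"
    by (simp add: Lone_dist_eq_measure)
qed


section \<open>Simplicial complexes and the spaces attached to them\<close>

definition simplicial_complex_over :: "'s set \<Rightarrow> 's set set \<Rightarrow> bool" where
  "simplicial_complex_over S K \<longleftrightarrow>
    (\<forall>F\<in>K. F \<noteq> {} \<and> finite F \<and> F \<subseteq> S) \<and> (\<forall>F\<in>K. \<forall>G. G \<subseteq> F \<and> G \<noteq> {} \<longrightarrow> G \<in> K)"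

definition complex_L :: "'w measure \<Rightarrow> 's set \<Rightarrow> 's set set \<Rightarrow> ('w \<Rightarrow> 's) set topology" where
  "complex_L M S K =
    Metric_space.mtopology (ae_class M S ` {f \<in> random_vars M S. essential_image M f \<in> K}) (Lone_dist M)"

definition closed_simplex :: "'s set \<Rightarrow> 's pmf set" where
  "closed_simplex F = {p. set_pmf p \<subseteq> F}"

text \<open>
  The Euclidean topology of a closed simplex: for finite \<open>F\<close>, the one induced by the coordinates
  \<open>pmf p s\<close>.
\<close>
definition simplex_topology :: "'s set \<Rightarrow> 's pmf topology" where
  "simplex_topology F = pullback_topology (closed_simplex F) pmf euclidean"

definition geometric_realization :: "'s set set \<Rightarrow> 's pmf topology" where
  "geometric_realization K =
    topology (\<lambda>U. U \<subseteq> {p. set_pmf p \<in> K} \<and>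
      (\<forall>F\<in>K. openin (simplex_topology F) (U \<inter> closed_simplex F)))"

lemma topspace_simplex_topology [simp]: "topspace (simplex_topology F) = closed_simplex F"
  by (simp add: simplex_topology_def topspace_pullback_topology)

lemma openin_geometric_realization:
  "openin (geometric_realization K) U \<longleftrightarrow> U \<subseteq> {p. set_pmf p \<in> K} \<and>
    (\<forall>F\<in>K. openin (simplex_topology F) (U \<inter> closed_simplex F))"
proof -
  have "istopology (\<lambda>U. U \<subseteq> {p. set_pmf p \<in> K} \<and>
      (\<forall>F\<in>K. openin (simplex_topology F) (U \<inter> closed_simplex F)))"
    unfolding istopology_def
  proof (intro conjI allI impI; (elim conjE)?)
    fix U V
    assume "\<forall>F\<in>K. openin (simplex_topology F) (U \<inter> closed_simplex F)"
      "\<forall>F\<in>K. openin (simplex_topology F) (V \<inter> closed_simplex F)"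
    moreover have "(U \<inter> V) \<inter> A = (U \<inter> A) \<inter> (V \<inter> A)" for A by blast
    ultimately show "\<forall>F\<in>K. openin (simplex_topology F) ((U \<inter> V) \<inter> closed_simplex F)"
      by (simp add: openin_Int)
  next
    fix \<U>
    assume *: "\<forall>U\<in>\<U>. U \<subseteq> {p. set_pmf p \<in> K} \<and>
      (\<forall>F\<in>K. openin (simplex_topology F) (U \<inter> closed_simplex F))"
    have "\<Union>\<U> \<inter> closed_simplex F = (\<Union>U\<in>\<U>. U \<inter> closed_simplex F)" for F :: "'a set" by blast
    then show "\<forall>F\<in>K. openin (simplex_topology F) (\<Union>\<U> \<inter> closed_simplex F)"
      using * by (simp only:) (blast intro: openin_Union)
  qed auto
  then show ?thesis by (simp add: geometric_realization_def topology_inverse')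
qed

lemma topspace_geometric_realization:
  assumes "simplicial_complex_over S K"
  shows "topspace (geometric_realization K) = {p. set_pmf p \<in> K}"
proof -
  have eq: "{p. set_pmf p \<in> K} \<inter> closed_simplex F = closed_simplex F" if "F \<in> K" for F
  proof -
    have "G \<in> K" if "G \<subseteq> F" "G \<noteq> {}" for G
      using assms \<open>F \<in> K\<close> that unfolding simplicial_complex_over_def by blast
    from this[OF _ set_pmf_not_empty] show ?thesis by (auto simp: closed_simplex_def)
  qed
  have "openin (geometric_realization K) {p. set_pmf p \<in> K}"
    unfolding openin_geometric_realization
  proof (intro conjI ballI)
    fix F assume "F \<in> K"
    show "openin (simplex_topology F) ({p. set_pmf p \<in> K} \<inter> closed_simplex F)"
      unfolding eq[OF \<open>F \<in> K\<close>] using openin_topspace[of "simplex_topology F"] by simp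
  qed simp
  then show ?thesis
    using openin_subset[of "geometric_realization K"] openin_geometric_realization[of K "topspace (geometric_realization K)"]
    by (auto intro!: subset_antisym)
qed


section \<open>Quotient spaces\<close>

definition generated_equiv :: "'a set \<Rightarrow> 'a rel \<Rightarrow> 'a rel" where
  "generated_equiv A R = (R \<union> R\<inverse>)\<^sup>* \<inter> (A \<times> A)"

definition quotient_space :: "'a topology \<Rightarrow> 'a rel \<Rightarrow> 'a set topology" where
  "quotient_space X E = topology (\<lambda>U. U \<subseteq> topspace X // E \<and> openin X (\<Union>U))"

lemma equiv_generated_equiv: "equiv A (generated_equiv A R)"
proof (rule equivI)
  have "sym (R \<union> R\<inverse>)" by (auto simp: sym_def)
  then have "sym ((R \<union> R\<inverse>)\<^sup>*)" by (rule sym_rtrancl)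
  then show "sym (generated_equiv A R)" by (auto simp: sym_def generated_equiv_def)
  show "trans (generated_equiv A R)"
    by (auto simp: trans_def generated_equiv_def intro: rtrancl_trans)
qed (auto simp: generated_equiv_def refl_on_def)

lemma generated_equiv_superset: "R \<subseteq> A \<times> A \<Longrightarrow> R \<subseteq> generated_equiv A R"
  by (auto simp: generated_equiv_def)

lemma generated_equiv_least:
  assumes "equiv A E" "R \<subseteq> E"
  shows "generated_equiv A R \<subseteq> E"
proof -
  have "y \<in> A \<longrightarrow> (x, y) \<in> E" if "(x, y) \<in> (R \<union> R\<inverse>)\<^sup>*" "x \<in> A" for x y
    using that
  proof (induction rule: rtrancl_induct)
    case base then show ?case using assms(1) by (simp add: equiv_def refl_on_def)
  next
    case (step y z)
    then have "(y, z) \<in> E" using assms by (auto simp: equiv_def dest: symD)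
    moreover from this have "y \<in> A" using assms(1) by (auto dest: equiv_class_eq_iff[THEN iffD1])
    ultimately show ?case using step assms(1) by (auto simp: equiv_def dest: transD)
  qed
  then show ?thesis by (auto simp: generated_equiv_def)
qed

lemma openin_quotient_space:
  assumes E: "equiv (topspace X) E"
  shows "openin (quotient_space X E) U \<longleftrightarrow> U \<subseteq> topspace X // E \<and> openin X (\<Union>U)"
proof -
  have "istopology (\<lambda>U. U \<subseteq> topspace X // E \<and> openin X (\<Union>U))"
    unfolding istopology_def
  proof (intro conjI allI impI; (elim conjE)?)
    fix U V assume *: "U \<subseteq> topspace X // E" "V \<subseteq> topspace X // E" "openin X (\<Union>U)" "openin X (\<Union>V)"
    have "\<Union>(U \<inter> V) = \<Union>U \<inter> \<Union>V"
      using *(1,2) quotient_disj[OF E] by blast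
    then show "openin X (\<Union>(U \<inter> V))" using * by (simp add: openin_Int)
  next
    fix \<U> assume "\<forall>U\<in>\<U>. U \<subseteq> topspace X // E \<and> openin X (\<Union>U)"
    moreover have "\<Union>(\<Union>\<U>) = (\<Union>U\<in>\<U>. \<Union>U)" by blast
    ultimately show "openin X (\<Union>(\<Union>\<U>))" by auto
  qed auto
  then show ?thesis by (simp add: quotient_space_def topology_inverse')
qed

lemma quotient_map_quotient_space:
  assumes E: "equiv (topspace X) E"
  shows "quotient_map X (quotient_space X E) (\<lambda>x. E `` {x})"
proof -
  have top: "topspace (quotient_space X E) = topspace X // E"
  proof -
    have "openin (quotient_space X E) (topspace X // E)"
      using Union_quotient[OF E] by (simp add: openin_quotient_space[OF E])
    then show ?thesis
      by (metis openin_quotient_space[OF E] openin_subset openin_topspace subset_antisym)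
  qed
  have "{x \<in> topspace X. E `` {x} \<in> U} = \<Union>U" if "U \<subseteq> topspace X // E" for U
  proof (intro equalityI subsetI)
    fix x assume "x \<in> {x \<in> topspace X. E `` {x} \<in> U}"
    then show "x \<in> \<Union>U" using equiv_class_self[OF E] by blast
  next
    fix x assume "x \<in> \<Union>U"
    then obtain C where C: "C \<in> U" "x \<in> C" by blast
    then have "C \<in> topspace X // E" using that by blast
    then obtain y where y: "y \<in> topspace X" "C = E `` {y}" by (auto elim: quotientE)
    then have "(y, x) \<in> E" using C by simp
    then have "E `` {x} = C" "x \<in> topspace X"
      using y equiv_class_eq[OF E] equiv_class_eq_iff[OF E, of y x] by auto
    then show "x \<in> {x \<in> topspace X. E `` {x} \<in> U}" using C by simp
  qed
  then show ?thesis
    unfolding quotient_map_def top by (auto simp: openin_quotient_space[OF E] quotient_def)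
qed


section \<open>Simplicial and pre-simplicial sets\<close>

text \<open>
  The object \<open>[n]\<close> is \<open>{..n}\<close>; a morphism is an extensional function. The two categories
  are given by their hom-sets.
\<close>
definition Delta_hom :: "nat \<Rightarrow> nat \<Rightarrow> (nat \<Rightarrow> nat) set" where
  "Delta_hom m n = {f \<in> {..m} \<rightarrow>\<^sub>E {..n}. mono_on {..m} f}"

definition Inj_hom :: "nat \<Rightarrow> nat \<Rightarrow> (nat \<Rightarrow> nat) set" where
  "Inj_hom m n = {f \<in> Delta_hom m n. inj_on f {..m}}"

text \<open>
  A presheaf of sets: \<open>cells F n\<close> is the value at \<open>[n]\<close>, and \<open>act F m n f\<close> is the map from
  \<open>cells F n\<close> to \<open>cells F m\<close> induced by \<open>f : [m] \<rightarrow> [n]\<close>.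
\<close>
record 'a presheaf =
  cells :: "nat \<Rightarrow> 'a set"
  act :: "nat \<Rightarrow> nat \<Rightarrow> (nat \<Rightarrow> nat) \<Rightarrow> 'a \<Rightarrow> 'a"

definition presheaf_on :: "(nat \<Rightarrow> nat \<Rightarrow> (nat \<Rightarrow> nat) set) \<Rightarrow> 'a presheaf \<Rightarrow> bool" where
  "presheaf_on Hom F \<longleftrightarrow>
    (\<forall>m n. \<forall>f\<in>Hom m n. act F m n f \<in> cells F n \<rightarrow> cells F m) \<and>
    (\<forall>n. \<forall>\<alpha>\<in>cells F n. act F n n (\<lambda>i\<in>{..n}. i) \<alpha> = \<alpha>) \<and>
    (\<forall>l m n. \<forall>f\<in>Hom l m. \<forall>g\<in>Hom m n. \<forall>\<alpha>\<in>cells F n.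
      act F l n (compose {..l} g f) \<alpha> = act F l m f (act F m n g \<alpha>))"

abbreviation simplicial_set :: "'a presheaf \<Rightarrow> bool" where
  "simplicial_set \<equiv> presheaf_on Delta_hom"

abbreviation presimplicial_set :: "'a presheaf \<Rightarrow> bool" where
  "presimplicial_set \<equiv> presheaf_on Inj_hom"

definition restrict_to_Inj :: "'a presheaf \<Rightarrow> 'a presheaf" where
  "restrict_to_Inj F =
    \<lparr>cells = cells F, act = (\<lambda>m n. \<lambda>f\<in>Inj_hom m n. act F m n f)\<rparr>"

text \<open>The tuple \<open>(s\<^sub>0, \<dots>, s\<^sub>n)\<close> is a list of length \<open>n + 1\<close>.\<close>
definition SK :: "'s::linorder set set \<Rightarrow> 's list presheaf" where
  "SK K =
    \<lparr>cells = (\<lambda>n. {xs. length xs = Suc n \<and> sorted xs \<and> set xs \<in> K}),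
     act = (\<lambda>m n f xs. map (\<lambda>i. xs ! f i) [0..<Suc m])\<rparr>"

text \<open>
  A cell of \<open>SK K\<close> is an order-preserving map \<open>[n] \<rightarrow> S\<close> with image in \<open>K\<close>. Restricting to the
  category of injective order-preserving maps is read as applying to the cells as well: the cells
  of \<open>MK K\<close> are the strictly increasing tuples. Restricting the functor alone would keep the
  degenerate tuples, which are not collapsed by injective maps; \<open>restrict_to_Inj (SK K)\<close>
  then realizes to a different space already when \<open>K\<close> is a single vertex, see
  \<open>degenerate_cells_not_homeomorphic\<close> below.
\<close>
definition MK :: "'s::linorder set set \<Rightarrow> 's list presheaf" where
  "MK K = (restrict_to_Inj (SK K))\<lparr>cells := (\<lambda>n. {xs \<in> cells (SK K) n. distinct xs})\<rparr>"

definition nabla :: "'w measure \<Rightarrow> nat \<Rightarrow> ('w \<Rightarrow> nat) set topology" where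
  "nabla M n = Metric_space.mtopology (Lone M {..n}) (Lone_dist M)"

definition cell_sum ::
  "'w measure \<Rightarrow> 'a presheaf \<Rightarrow> (nat \<times> 'a \<times> ('w \<Rightarrow> nat) set) topology" where
  "cell_sum M F = sum_topology (\<lambda>n. prod_topology (discrete_topology (cells F n)) (nabla M n)) UNIV"

definition glue_rel ::
  "(nat \<Rightarrow> nat \<Rightarrow> (nat \<Rightarrow> nat) set) \<Rightarrow> 'w measure \<Rightarrow> 'a presheaf
    \<Rightarrow> (nat \<times> 'a \<times> ('w \<Rightarrow> nat) set) rel" where
  "glue_rel Hom M F =
    {((n, act F n m \<sigma> \<alpha>, a), (m, \<alpha>, Lone_map M {..m} \<sigma> a)) | n m \<sigma> \<alpha> a.
      \<sigma> \<in> Hom n m \<and> \<alpha> \<in> cells F m \<and> a \<in> Lone M {..n}}"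

definition presheaf_L ::
  "(nat \<Rightarrow> nat \<Rightarrow> (nat \<Rightarrow> nat) set) \<Rightarrow> 'w measure \<Rightarrow> 'a presheaf
    \<Rightarrow> (nat \<times> 'a \<times> ('w \<Rightarrow> nat) set) set topology" where
  "presheaf_L Hom M F =
    quotient_space (cell_sum M F) (generated_equiv (topspace (cell_sum M F)) (glue_rel Hom M F))"

definition simplicial_L ::
  "'w measure \<Rightarrow> 'a presheaf \<Rightarrow> (nat \<times> 'a \<times> ('w \<Rightarrow> nat) set) set topology" where
  "simplicial_L M F = presheaf_L Delta_hom M F"

definition presimplicial_L ::
  "'w measure \<Rightarrow> 'a presheaf \<Rightarrow> (nat \<times> 'a \<times> ('w \<Rightarrow> nat) set) set topology" where
  "presimplicial_L M F = presheaf_L Inj_hom M F"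

lemma simplicial_set_SK:
  assumes K: "simplicial_complex_over S K"
  shows "simplicial_set (SK K)"
  unfolding presheaf_on_def
proof (intro conjI allI ballI funcsetI)
  fix m n f xs assume f: "f \<in> Delta_hom m n" and xs: "xs \<in> cells (SK K) n"
  let ?ys = "map (\<lambda>i. xs ! f i) [0..<Suc m]"
  have le: "f i \<le> n" if "i \<le> m" for i using f that by (auto simp: Delta_hom_def)
  have mono: "f i \<le> f j" if "i \<le> j" "j \<le> m" for i j
    using f that by (auto simp: Delta_hom_def mono_on_def)
  have "sorted ?ys"
    unfolding sorted_iff_nth_mono
  proof (intro allI impI)
    fix i j assume "i \<le> j" "j < length ?ys"
    moreover from this have "xs ! f i \<le> xs ! f j"
      using xs mono[of i j] le[of j] by (intro sorted_nth_mono) (auto simp: SK_def less_Suc_eq_le)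
    ultimately show "?ys ! i \<le> ?ys ! j" by (simp del: upt_Suc)
  qed
  moreover have "xs ! f i \<in> set xs" if "i \<le> m" for i
    using xs le[OF that] by (intro nth_mem) (simp add: SK_def)
  then have "set ?ys \<subseteq> set xs" by (auto simp: less_Suc_eq_le simp del: upt_Suc)
  then have "set ?ys \<in> K"
    using K xs by (auto simp: SK_def simplicial_complex_over_def simp del: upt_Suc set_map)
  ultimately show "act (SK K) m n f xs \<in> cells (SK K) m" by (simp add: SK_def del: upt_Suc)
next
  fix n xs assume "xs \<in> cells (SK K) n"
  then show "act (SK K) n n (\<lambda>i\<in>{..n}. i) xs = xs"
    by (auto simp: SK_def simp del: upt_Suc intro!: nth_equalityI)
next
  fix l m n f g xs
  assume "f \<in> Delta_hom l m" "g \<in> Delta_hom m n" "xs \<in> cells (SK K) n"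
  then show "act (SK K) l n (compose {..l} g f) xs = act (SK K) l m f (act (SK K) m n g xs)"
    by (auto simp: SK_def Delta_hom_def compose_def PiE_iff less_Suc_eq_le simp del: upt_Suc
        intro!: nth_equalityI)
qed

lemma presimplicial_set_MK:
  assumes K: "simplicial_complex_over S K"
  shows "presimplicial_set (MK K)"
proof -
  note SK = simplicial_set_SK[OF K, unfolded presheaf_on_def]
  have sub: "f \<in> Inj_hom m n \<Longrightarrow> f \<in> Delta_hom m n" for f m n by (simp add: Inj_hom_def)
  have comp: "compose {..l} g f \<in> Inj_hom l n" if "f \<in> Inj_hom l m" "g \<in> Inj_hom m n" for f g l m n
  proof -
    have f: "f \<in> {..l} \<rightarrow> {..m}" "mono_on {..l} f" "inj_on f {..l}"
      and g: "g \<in> {..m} \<rightarrow> {..n}" "mono_on {..m} g" "inj_on g {..m}"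
      using that by (auto simp: Inj_hom_def Delta_hom_def)
    have "mono_on {..l} (compose {..l} g f)"
    proof (rule mono_onI)
      fix i j assume "i \<in> {..l}" "j \<in> {..l}" "i \<le> j"
      moreover from this have "f i \<le> f j" "f i \<in> {..m}" "f j \<in> {..m}"
        using f(1,2) by (auto simp: mono_on_def)
      ultimately show "compose {..l} g f i \<le> compose {..l} g f j"
        using g(2) by (simp add: compose_eq mono_on_def)
    qed
    moreover have "inj_on (compose {..l} g f) {..l}"
    proof (rule inj_onI)
      fix i j assume ij: "i \<in> {..l}" "j \<in> {..l}" "compose {..l} g f i = compose {..l} g f j"
      then have "g (f i) = g (f j)" "f i \<in> {..m}" "f j \<in> {..m}"
        using f(1) by (auto simp: compose_eq)
      then have "f i = f j" by (rule inj_onD[OF g(3)])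
      then show "i = j" using ij(1,2) by (rule inj_onD[OF f(3)])
    qed
    moreover have "compose {..l} g f \<in> {..l} \<rightarrow>\<^sub>E {..n}"
      using funcset_compose[OF f(1) g(1)] by (simp add: PiE_def)
    ultimately show ?thesis by (simp add: Inj_hom_def Delta_hom_def)
  qed
  have ident: "(\<lambda>i\<in>{..n}. i) \<in> Inj_hom n n" for n :: nat
    by (auto simp: Inj_hom_def Delta_hom_def mono_on_def inj_on_def)
  have dist: "distinct (act (SK K) m n f xs)"
    if "f \<in> Inj_hom m n" "xs \<in> cells (SK K) n" "distinct xs" for f m n xs
  proof -
    have f: "f \<in> {..m} \<rightarrow> {..n}" "inj_on f {..m}"
      using that(1) by (auto simp: Inj_hom_def Delta_hom_def)
    have len: "length xs = Suc n" using that(2) by (simp add: SK_def)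
    have "inj_on (\<lambda>i. xs ! f i) {..m}"
    proof (rule inj_onI)
      fix i j assume ij: "i \<in> {..m}" "j \<in> {..m}" "xs ! f i = xs ! f j"
      then have "f i < length xs" "f j < length xs" using f(1) len by (auto simp: less_Suc_eq_le)
      then have "f i = f j" using nth_eq_iff_index_eq[OF that(3)] ij(3) by blast
      then show "i = j" using ij(1,2) by (rule inj_onD[OF f(2)])
    qed
    moreover have "{0..<Suc m} = {..m}" by auto
    ultimately show ?thesis by (simp add: SK_def distinct_map del: upt_Suc)
  qed
  have cells: "act (SK K) m n f xs \<in> cells (SK K) m"
    if "f \<in> Inj_hom m n" "xs \<in> cells (SK K) n" for f m n xs
    using SK[THEN conjunct1, rule_format, OF sub[OF that(1)]] that(2) by (rule funcset_mem)
  show ?thesis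
    unfolding presheaf_on_def
  proof (intro conjI allI ballI funcsetI)
    fix m n f xs assume "f \<in> Inj_hom m n" "xs \<in> cells (MK K) n"
    then show "act (MK K) m n f xs \<in> cells (MK K) m"
      using dist cells by (simp add: MK_def restrict_to_Inj_def)
  next
    fix n xs assume "xs \<in> cells (MK K) n"
    then show "act (MK K) n n (\<lambda>i\<in>{..n}. i) xs = xs"
      using SK[THEN conjunct2, THEN conjunct1] ident[of n] by (simp add: MK_def restrict_to_Inj_def)
  next
    fix l m n f g xs
    assume *: "f \<in> Inj_hom l m" "g \<in> Inj_hom m n" "xs \<in> cells (MK K) n"
    then have "act (SK K) l n (compose {..l} g f) xs = act (SK K) l m f (act (SK K) m n g xs)"
      by (intro SK[THEN conjunct2, THEN conjunct2, rule_format, of f l m g n xs] sub)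
        (simp_all add: MK_def)
    then show "act (MK K) l n (compose {..l} g f) xs = act (MK K) l m f (act (MK K) m n g xs)"
      using * comp[OF *(1,2)] by (simp add: MK_def restrict_to_Inj_def)
  qed
qed

lemma topspace_cell_sum:
  assumes "prob_space M" "complete_measure M"
  shows "topspace (cell_sum M F) = (SIGMA n:UNIV. cells F n \<times> Lone M {..n})"
  by (simp add: cell_sum_def nabla_def comp_def
      Metric_space.topspace_mtopology[OF Metric_space_Lone[OF assms]])

lemma topspace_presheaf_L:
  "topspace (presheaf_L Hom M F) =
    (\<lambda>x. generated_equiv (topspace (cell_sum M F)) (glue_rel Hom M F) `` {x}) ` topspace (cell_sum M F)"
  unfolding presheaf_L_def
  by (rule quotient_imp_surjective_map[OF quotient_map_quotient_space, symmetric])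
    (rule equiv_generated_equiv)

lemma degenerate_cells_not_homeomorphic:
  fixes M :: "'w measure" and s :: "'s::linorder"
  assumes P: "prob_space M" and C: "complete_measure M" and A: "atomless M"
  shows "\<not> simplicial_L M (SK {{s}}) homeomorphic_space presimplicial_L M (restrict_to_Inj (SK {{s}}))"
proof
  interpret prob_space M by fact
  let ?K = "{{s}}"
  let ?X = "simplicial_L M (SK ?K)" and ?Y = "presimplicial_L M (restrict_to_Inj (SK ?K))"
  note top = topspace_cell_sum[OF P C]
  let ?A = "topspace (cell_sum M (SK ?K))"
  let ?E = "generated_equiv ?A (glue_rel Delta_hom M (SK ?K))"
  have rv0: "(\<lambda>_. 0) \<in> random_vars M {..0::nat}" by (simp add: random_vars_countable)
  have unique: "F = G" if "F \<in> Lone M {..0::nat}" "G \<in> Lone M {..0}" for F G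
  proof -
    have "rv_rep F t = 0" "rv_rep G t = 0" if "t \<in> space M" for t
      using rv_rep_in(1)[OF \<open>F \<in> _\<close>] rv_rep_in(1)[OF \<open>G \<in> _\<close>] measurable_space[OF _ that, of _ "count_space {..0::nat}"]
      by (auto simp: random_vars_def)
    then have "AE t in M. rv_rep F t = rv_rep G t" by (intro AE_I2) simp
    then show "F = G"
      using ae_class_eq_iff[OF rv_rep_in(1)[OF that(1)] rv_rep_in(1)[OF that(2)]]
        rv_rep_in(2)[OF that(1)] rv_rep_in(2)[OF that(2)] by simp
  qed
  have s0: "[s] \<in> cells (SK ?K) 0" by (simp add: SK_def)
  define c0 where "c0 = ae_class M {..0::nat} (\<lambda>_. 0)"
  have c0: "c0 \<in> Lone M {..0::nat}" using rv0 by (simp add: c0_def Lone_def)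
  have to_pt: "(x, (0, [s], c0)) \<in> ?E" if x: "x \<in> ?A" for x
  proof -
    obtain n xs a where nxa: "x = (n, xs, a)" "xs \<in> cells (SK ?K) n" "a \<in> Lone M {..n}"
      using x unfolding top by auto
    let ?\<sigma> = "\<lambda>i\<in>{..n}. 0::nat"
    have "?\<sigma> \<in> Delta_hom n 0" by (auto simp: Delta_hom_def mono_on_def)
    moreover have "xs = act (SK ?K) n 0 ?\<sigma> [s]"
    proof (rule nth_equalityI)
      have len: "length xs = Suc n" "set xs = {s}" using nxa(2) by (auto simp: SK_def)
      show "length xs = length (act (SK ?K) n 0 ?\<sigma> [s])" using len by (simp add: SK_def)
      fix i assume "i < length xs"
      then have "xs ! i = s" using len nth_mem by blast
      then show "xs ! i = act (SK ?K) n 0 ?\<sigma> [s] ! i"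
        using \<open>i < length xs\<close> len by (simp add: SK_def del: upt_Suc)
    qed
    moreover have "Lone_map M {..0} ?\<sigma> a = c0"
    proof (rule unique[OF _ c0])
      have "?\<sigma> \<circ> rv_rep a \<in> random_vars M {..0}"
        using rv_rep_in(1)[OF nxa(3)]
        by (auto simp: random_vars_countable intro!: measurable_comp[of _ _ "count_space {..n}"])
      then show "Lone_map M {..0} ?\<sigma> a \<in> Lone M {..0}" by (simp add: Lone_map_def Lone_def)
    qed
    ultimately have "(x, (0, [s], c0)) \<in> glue_rel Delta_hom M (SK ?K)"
      using nxa s0 unfolding glue_rel_def by blast
    then have "(x, (0, [s], c0)) \<in> (glue_rel Delta_hom M (SK ?K) \<union> (glue_rel Delta_hom M (SK ?K))\<inverse>)\<^sup>*"
      by blast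
    moreover have "(0, [s], c0) \<in> ?A" using s0 c0 by (simp add: top)
    ultimately show ?thesis using x by (simp add: generated_equiv_def)
  qed
  have "?E `` {x} = ?E `` {(0, [s], c0)}" if "x \<in> ?A" for x
    by (rule equiv_class_eq[OF equiv_generated_equiv to_pt[OF that]])
  then have X: "topspace ?X \<subseteq> {?E `` {(0, [s], c0)}}"
    unfolding simplicial_L_def topspace_presheaf_L by blast

  let ?F = "restrict_to_Inj (SK ?K)"
  let ?A' = "topspace (cell_sum M ?F)"
  let ?R = "glue_rel Inj_hom M ?F"
  let ?E' = "generated_equiv ?A' ?R"
  define const where "const = (\<lambda>(n::nat, xs::'s list, a). \<exists>i::nat. AE t in M. rv_rep a t = i)"
  have inv1: "const x = const y" if "(x, y) \<in> ?R" for x y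
  proof -
    obtain n m \<sigma> \<alpha> a where *: "x = (n, act ?F n m \<sigma> \<alpha>, a)" "y = (m, \<alpha>, Lone_map M {..m} \<sigma> a)"
      "\<sigma> \<in> Inj_hom n m" "a \<in> Lone M {..n}"
      using \<open>(x, y) \<in> ?R\<close> unfolding glue_rel_def by blast
    have \<sigma>: "\<sigma> \<in> {..n} \<rightarrow> {..m}" "inj_on \<sigma> {..n}" using *(3) by (auto simp: Inj_hom_def Delta_hom_def)
    have "\<sigma> \<circ> rv_rep a \<in> random_vars M {..m}"
      using rv_rep_in(1)[OF *(4)] \<sigma>(1)
      by (auto simp: random_vars_countable intro!: measurable_comp[of _ _ "count_space {..n}"])
    from rv_rep_ae_class[OF this]
    have ae: "AE t in M. rv_rep (Lone_map M {..m} \<sigma> a) t = \<sigma> (rv_rep a t)" by (simp add: Lone_map_def)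
    have ran: "AE t in M. rv_rep a t \<in> {..n}"
      using rv_rep_in(1)[OF *(4)] by (intro AE_I2) (auto simp: random_vars_def dest: measurable_space)
    show ?thesis
    proof
      assume "const x"
      then obtain i where "AE t in M. rv_rep a t = i" by (auto simp: const_def *)
      with ae have "AE t in M. rv_rep (Lone_map M {..m} \<sigma> a) t = \<sigma> i" by eventually_elim simp
      then show "const y" by (auto simp: const_def *)
    next
      assume "const y"
      then obtain j where "AE t in M. rv_rep (Lone_map M {..m} \<sigma> a) t = j" by (auto simp: const_def *)
      with ae ran have "AE t in M. rv_rep a t = inv_into {..n} \<sigma> j"
        by eventually_elim (use \<sigma>(2) in \<open>auto simp: inv_into_f_f\<close>)
      then show "const x" by (auto simp: const_def *)
    qed
  qed
  have inv: "const x = const y" if "(x, y) \<in> ?E'" for x y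
  proof -
    have "(x, y) \<in> (?R \<union> ?R\<inverse>)\<^sup>*" using that by (simp add: generated_equiv_def)
    then show ?thesis by (induction rule: rtrancl_induct) (auto dest: inv1)
  qed
  obtain B where B: "B \<in> sets M" "0 < measure M B" "measure M B < 1"
    using A[unfolded atomless_def, rule_format, of "space M"] by (auto simp: prob_space)
  define b where "b = (\<lambda>t. if t \<in> B then 1 else 0::nat)"
  have b: "b \<in> random_vars M {..1}"
    unfolding b_def using B(1)
    by (auto simp: random_vars_countable intro!: measurable_If_set)
  define p q where "p = (0::nat, [s], c0)" and "q = (1::nat, [s, s], ae_class M {..1} b)"
  have pq: "p \<in> ?A'" "q \<in> ?A'"
    using c0 b by (auto simp: p_def q_def top restrict_to_Inj_def SK_def Lone_def)
  have "const p" using rv_rep_ae_class[OF rv0] by (auto simp: const_def p_def c0_def)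
  moreover have "\<not> const q"
  proof
    assume "const q"
    then obtain i where "AE t in M. rv_rep (ae_class M {..1} b) t = i" by (auto simp: const_def q_def)
    with rv_rep_ae_class[OF b] have ae: "AE t in M. b t = i" by eventually_elim simp
    show False
    proof (cases "i = 1")
      case True
      then have "AE t in M. t \<in> B" using ae by (auto simp: b_def elim: eventually_mono split: if_splits)
      then show False using B prob_eq_1[OF B(1)] by simp
    next
      case False
      then have "AE t in M. t \<notin> B" using ae by (auto simp: b_def elim: eventually_mono split: if_splits)
      then show False using B prob_eq_0[OF B(1)] by simp
    qed
  qed
  ultimately have "(p, q) \<notin> ?E'" using inv by blast
  then have ne: "?E' `` {p} \<noteq> ?E' `` {q}"
    using eq_equiv_class[OF _ equiv_generated_equiv pq(2)] by blast
  have Y: "?E' `` {p} \<in> topspace ?Y" "?E' `` {q} \<in> topspace ?Y"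
    unfolding presimplicial_L_def topspace_presheaf_L using pq by blast+
  assume "?X homeomorphic_space ?Y"
  then obtain f where f: "homeomorphic_map ?X ?Y f" by (auto simp: homeomorphic_space)
  then have "topspace ?Y = f ` topspace ?X" using homeomorphic_imp_surjective_map by blast
  then have "topspace ?Y \<subseteq> {f (?E `` {(0, [s], c0)})}" using X by blast
  then show False using Y ne by blast
qed

end

theory Submission
  imports Defs
begin

text \<open>
  Write \<open>Lw\<close> for the set \<open>L(K)\<close> with the weak topology determined by the subspaces \<open>L(F)\<close> of random
  variables with essential image in \<open>F\<close>, for \<open>F \<in> K\<close> (\<open>weak_L\<close> below).

  A cell \<open>(s\<^sub>0, \<dots>, s\<^sub>n)\<close> and a random index \<open>a\<close> with values in \<open>[n]\<close> describe the random variable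
  \<open>t \<mapsto> s\<^bsub>a t\<^esub>\<close>. This map is a quotient map from the disjoint sum onto \<open>Lw\<close>, since on a cell without
  repetitions it is an isometry onto \<open>L(F)\<close>. Two points have the same image exactly
  when they are glued, for each point is glued to the one on the cell that lists the essential image
  of its random variable. This holds for the simplicial set and for the pre-simplicial set of
  non-degenerate cells alike, so both realizations are homeomorphic to \<open>Lw\<close>
  (\<open>presheaf_L_homeomorphic_weak_L\<close>).

  It remains to compare \<open>Lw\<close> and the metric space \<open>L(K)\<close> with \<open>|K|\<close>. As the probability space is
  atomless, it contains a nested family of events \<open>T t\<close> of probability \<open>t\<close> (\<open>ex_nested_events\<close>). As the
  vertices are linearly ordered, every \<open>p\<close> in \<open>|K|\<close> is the law of a quantile function with
  respect to this family, which gives a continuous section \<open>realize\<close> of the law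
  (\<open>continuous_map_realize_weak_L\<close>). In the other direction the law is not continuous from
  the metric topology to the weak topology. It becomes so after subtracting half of its largest value
  from all probabilities, dropping what is not positive, and rescaling:
  locally only finitely many vertices, forming a simplex, survive (\<open>continuous_map_approx_law\<close>).

  On \<open>|K|\<close>, subtracting a variable part of the largest value joins the composite of the two maps to the
  identity (\<open>shrink_homotopic_id\<close>). On random variables the other composite \<open>g\<close> never enlarges the
  essential image, and the random variable equal to \<open>g(f)\<close> on \<open>T t\<close> and to \<open>f\<close>
  elsewhere joins \<open>f\<close> to \<open>g(f)\<close>. This homotopy is continuous for the metric; it preserves the subspaces
  \<open>L(F)\<close>, hence is also continuous for \<open>Lw\<close>, as the product with an interval preserves quotient
  maps (\<open>continuous_map_replacement_weak_L\<close>).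
\<close>

section \<open>Weak topologies, quotients and continuity\<close>

text \<open>
  The weak topology determined by a family of spaces, whose underlying sets may overlap: a set is
  open when its trace on every member of the family is open.
\<close>
definition weak_topology :: "'i set \<Rightarrow> ('i \<Rightarrow> 'a topology) \<Rightarrow> 'a topology" where
  "weak_topology I X =
    topology (\<lambda>U. U \<subseteq> (\<Union>i\<in>I. topspace (X i)) \<and> (\<forall>i\<in>I. openin (X i) (U \<inter> topspace (X i))))"

lemma openin_weak_topology:
  "openin (weak_topology I X) U \<longleftrightarrow>
    U \<subseteq> (\<Union>i\<in>I. topspace (X i)) \<and> (\<forall>i\<in>I. openin (X i) (U \<inter> topspace (X i)))"
proof -
  have "istopology (\<lambda>U. U \<subseteq> (\<Union>i\<in>I. topspace (X i)) \<and> (\<forall>i\<in>I. openin (X i) (U \<inter> topspace (X i))))"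
    unfolding istopology_def
  proof (intro conjI allI impI; (elim conjE)?)
    fix U V
    assume "\<forall>i\<in>I. openin (X i) (U \<inter> topspace (X i))" "\<forall>i\<in>I. openin (X i) (V \<inter> topspace (X i))"
    moreover have "(U \<inter> V) \<inter> A = (U \<inter> A) \<inter> (V \<inter> A)" for A by blast
    ultimately show "\<forall>i\<in>I. openin (X i) ((U \<inter> V) \<inter> topspace (X i))"
      by (simp add: openin_Int)
  next
    fix \<U>
    assume *: "\<forall>U\<in>\<U>. U \<subseteq> (\<Union>i\<in>I. topspace (X i)) \<and> (\<forall>i\<in>I. openin (X i) (U \<inter> topspace (X i)))"
    have "\<Union>\<U> \<inter> topspace (X i) = (\<Union>U\<in>\<U>. U \<inter> topspace (X i))" for i by blast
    then show "\<forall>i\<in>I. openin (X i) (\<Union>\<U> \<inter> topspace (X i))"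
      using * by (simp only:) (blast intro: openin_Union)
  qed auto
  then show ?thesis by (simp add: weak_topology_def topology_inverse')
qed

lemma topspace_weak_topology:
  "topspace (weak_topology I X) = (\<Union>i\<in>I. topspace (X i))"
proof -
  have "(\<Union>i\<in>I. topspace (X i)) \<inter> topspace (X j) = topspace (X j)" if "j \<in> I" for j
    using that by blast
  then have "openin (weak_topology I X) (\<Union>i\<in>I. topspace (X i))"
    by (simp add: openin_weak_topology)
  then show ?thesis
    using openin_subset openin_weak_topology[of I X "topspace (weak_topology I X)"]
    by (meson openin_topspace subset_antisym)
qed

lemma continuous_map_into_weak_topology:
  assumes "i \<in> I" "continuous_map Y (X i) f"
  shows "continuous_map Y (weak_topology I X) f"
proof -
  have "continuous_map (X i) (weak_topology I X) id"
    unfolding continuous_map_alt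
  proof (intro conjI allI impI)
    fix U assume "openin (weak_topology I X) U"
    then show "openin (X i) (id -` U \<inter> topspace (X i))"
      using assms(1) by (simp add: openin_weak_topology)
  qed (use assms(1) in \<open>auto simp: topspace_weak_topology\<close>)
  from continuous_map_compose[OF assms(2) this] show ?thesis by simp
qed

lemma quotient_map_weak_topology:
  "quotient_map (sum_topology X I) (weak_topology I X) snd"
  unfolding quotient_map_def
proof (intro conjI allI impI)
  show "snd ` topspace (sum_topology X I) = topspace (weak_topology I X)"
    by (force simp: topspace_weak_topology)
  fix U assume U: "U \<subseteq> topspace (weak_topology I X)"
  have "{x. (i, x) \<in> {z \<in> topspace (sum_topology X I). snd z \<in> U}} = U \<inter> topspace (X i)" if "i \<in> I" for i
    using that by auto
  then show "openin (sum_topology X I) {z \<in> topspace (sum_topology X I). snd z \<in> U} =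
      openin (weak_topology I X) U"
    using U by (auto simp: openin_sum_topology openin_weak_topology topspace_weak_topology)
qed

lemma continuous_map_from_weak_topology:
  assumes "\<And>i. i \<in> I \<Longrightarrow> continuous_map (X i) Y f"
  shows "continuous_map (weak_topology I X) Y f"
  unfolding continuous_map_alt
proof (intro conjI allI impI)
  show "f \<in> topspace (weak_topology I X) \<rightarrow> topspace Y"
    using assms by (force simp: topspace_weak_topology continuous_map_def)
  fix V assume V: "openin Y V"
  have "f -` V \<inter> topspace (weak_topology I X) \<inter> topspace (X i) = f -` V \<inter> topspace (X i)"
    if "i \<in> I" for i using that by (auto simp: topspace_weak_topology)
  then show "openin (weak_topology I X) (f -` V \<inter> topspace (weak_topology I X))"
    using assms V
    unfolding openin_weak_topology continuous_map_alt by (auto simp: topspace_weak_topology)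
qed

lemma continuous_map_prod_sum_topology:
  assumes "\<And>i. i \<in> I \<Longrightarrow> continuous_map (prod_topology Z (X i)) Y (\<lambda>(z, x). f (z, i, x))"
  shows "continuous_map (prod_topology Z (sum_topology X I)) Y f"
  unfolding continuous_map_alt
proof (intro conjI allI impI)
  show "f \<in> topspace (prod_topology Z (sum_topology X I)) \<rightarrow> topspace Y"
  proof
    fix w assume "w \<in> topspace (prod_topology Z (sum_topology X I))"
    then obtain z i x where w: "w = (z, i, x)" "i \<in> I" "(z, x) \<in> topspace (prod_topology Z (X i))"
      by auto
    then show "f w \<in> topspace Y"
      using funcset_mem[OF continuous_map_funspace[OF assms[OF w(2)]] w(3)] by simp
  qed
  fix V assume V: "openin Y V"
  show "openin (prod_topology Z (sum_topology X I)) (f -` V \<inter> topspace (prod_topology Z (sum_topology X I)))"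
    unfolding openin_prod_topology_alt
  proof (intro allI impI)
    fix z y assume "(z, y) \<in> f -` V \<inter> topspace (prod_topology Z (sum_topology X I))"
    then obtain i x where zix: "y = (i, x)" "i \<in> I" "z \<in> topspace Z" "x \<in> topspace (X i)" "f (z, i, x) \<in> V"
      by auto
    let ?W = "(\<lambda>(z, x). f (z, i, x)) -` V \<inter> topspace (prod_topology Z (X i))"
    have "openin (prod_topology Z (X i)) ?W"
      using assms[OF \<open>i \<in> I\<close>] V unfolding continuous_map_alt by blast
    moreover have "(z, x) \<in> ?W" using zix by simp
    ultimately obtain A B where AB: "openin Z A" "openin (X i) B" "z \<in> A" "x \<in> B" "A \<times> B \<subseteq> ?W"
      unfolding openin_prod_topology_alt by meson
    have "openin (sum_topology X I) (Pair i ` B)"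
      using open_map_component_injection[OF \<open>i \<in> I\<close>, of X] AB(2) by (simp add: open_map_def)
    moreover have "A \<times> Pair i ` B \<subseteq> f -` V \<inter> topspace (prod_topology Z (sum_topology X I))"
      using AB(5) \<open>i \<in> I\<close> by auto
    ultimately show "\<exists>A B. openin Z A \<and> openin (sum_topology X I) B \<and> z \<in> A \<and> y \<in> B \<and>
        A \<times> B \<subseteq> f -` V \<inter> topspace (prod_topology Z (sum_topology X I))"
      using AB(1,3,4) zix(1) by (intro exI conjI) auto
  qed
qed

text \<open>
  A map out of the product of the interval with a weak topology is continuous as soon as it is so
  on each member of the family: multiplication by a locally compact space preserves quotient maps.
\<close>
lemma continuous_map_interval_prod_weak_topology:
  assumes "\<And>i. i \<in> I \<Longrightarrow> continuous_map (prod_topology (top_of_set {0..1::real}) (X i)) Y f"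
  shows "continuous_map (prod_topology (top_of_set {0..1}) (weak_topology I X)) Y f"
proof -
  let ?Z = "top_of_set {0..1::real}"
  have "locally_compact_space ?Z" "Hausdorff_space ?Z"
    by (simp_all add: compact_imp_locally_compact_space compact_space_subtopology Hausdorff_space_subtopology)
  then have q: "quotient_map (prod_topology ?Z (sum_topology X I)) (prod_topology ?Z (weak_topology I X))
      (\<lambda>(t, z). (t, snd z))"
    by (intro quotient_map_prod_right quotient_map_weak_topology) auto
  have "continuous_map (prod_topology ?Z (sum_topology X I)) Y (f \<circ> (\<lambda>(t, z). (t, snd z)))"
    by (rule continuous_map_prod_sum_topology) (use assms in simp)
  then show ?thesis using continuous_compose_quotient_map_eq[OF q] by blast
qed

text \<open>
  A quotient by a relation that is the kernel of a quotient map is the target of that map.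
\<close>
lemma quotient_space_homeomorphic:
  assumes E: "equiv (topspace X) E" and f: "quotient_map X Y f"
    and ker: "\<And>x y. x \<in> topspace X \<Longrightarrow> y \<in> topspace X \<Longrightarrow> (x, y) \<in> E \<longleftrightarrow> f x = f y"
  shows "quotient_space X E homeomorphic_space Y"
proof -
  let ?p = "\<lambda>x. E `` {x}"
  note q = quotient_map_quotient_space[OF E]
  have pe: "?p x = ?p y \<longleftrightarrow> f x = f y" if "x \<in> topspace X" "y \<in> topspace X" for x y
    using eq_equiv_class_iff[OF E that] ker[OF that] by simp
  obtain g where g: "continuous_map (quotient_space X E) Y g" "\<And>x. x \<in> topspace X \<Longrightarrow> g (?p x) = f x"
    by (rule quotient_map_lift_exists[OF q quotient_imp_continuous_map[OF f]]) (use pe in blast)+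
  obtain h where h: "continuous_map Y (quotient_space X E) h" "\<And>x. x \<in> topspace X \<Longrightarrow> h (f x) = ?p x"
    by (rule quotient_map_lift_exists[OF f quotient_imp_continuous_map[OF q]]) (use pe in blast)+
  have "h (g c) = c" if "c \<in> topspace (quotient_space X E)" for c
  proof -
    have "c \<in> ?p ` topspace X" using that quotient_imp_surjective_map[OF q] by blast
    then show ?thesis using g(2) h(2) by force
  qed
  moreover have "g (h y) = y" if "y \<in> topspace Y" for y
  proof -
    have "y \<in> f ` topspace X" using that quotient_imp_surjective_map[OF f] by blast
    then show ?thesis using g(2) h(2) by force
  qed
  ultimately have "homeomorphic_maps (quotient_space X E) Y g h"
    using g(1) h(1) by (simp add: homeomorphic_maps_def)
  then show ?thesis by (rule homeomorphic_maps_imp_homeomorphic_space)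
qed

lemma (in Metric_space) continuous_map_to_metric_bound:
  assumes "f \<in> topspace X \<rightarrow> M"
    and "\<And>x. x \<in> topspace X \<Longrightarrow>
      \<exists>b. continuous_map X euclideanreal b \<and> b x = 0 \<and> (\<forall>y\<in>topspace X. d (f x) (f y) \<le> b y)"
  shows "continuous_map X mtopology f"
  unfolding continuous_map_to_metric
proof (intro ballI allI impI)
  fix x and e :: real assume x: "x \<in> topspace X" and e: "0 < e"
  obtain b where b: "continuous_map X euclideanreal b" "b x = 0" "\<forall>y\<in>topspace X. d (f x) (f y) \<le> b y"
    using assms(2)[OF x] by blast
  have "openin X {y \<in> topspace X. b y \<in> {..<e}}"
    by (rule openin_continuous_map_preimage[OF b(1)]) simp
  moreover have "f y \<in> mball (f x) e" if "y \<in> topspace X" "b y < e" for y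
    using b(3) that assms(1) x by (force simp: Pi_iff)
  ultimately show "\<exists>U. openin X U \<and> x \<in> U \<and> (\<forall>y\<in>U. f y \<in> mball (f x) e)"
    using b(2) x e by (intro exI[of _ "{y \<in> topspace X. b y \<in> {..<e}}"]) auto
qed

lemma (in Metric_space) continuous_map_nonexpansive:
  assumes "Metric_space M' d'" "f \<in> M \<rightarrow> M'" "\<And>x y. x \<in> M \<Longrightarrow> y \<in> M \<Longrightarrow> d' (f x) (f y) \<le> d x y"
  shows "continuous_map mtopology (Metric_space.mtopology M' d') f"
  unfolding metric_continuous_map[OF assms(1)]
  using assms(2,3) by (metis funcset_image order_le_less_trans)

lemma (in Metric_space) continuous_map_real_nonexpansive:
  assumes "\<And>x y. x \<in> M \<Longrightarrow> y \<in> M \<Longrightarrow> \<bar>f x - f y\<bar> \<le> d x y"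
  shows "continuous_map mtopology euclideanreal f"
  using continuous_map_nonexpansive[of UNIV dist f] assms Met_TC.Metric_space_axioms
  by (simp add: dist_real_def)

lemma (in Metric_space) continuous_map_dist_from:
  assumes "a \<in> M"
  shows "continuous_map mtopology euclideanreal (d a)"
  using assms by (intro continuous_map_real_nonexpansive) (metis commute mdist_reverse_triangle)

lemma homotopic_withI:
  assumes "continuous_map (prod_topology (top_of_set {0..1::real}) X) Y h"
    and "\<And>x. x \<in> topspace X \<Longrightarrow> h (0, x) = f x" "\<And>x. x \<in> topspace X \<Longrightarrow> h (1, x) = g x"
  shows "homotopic_with (\<lambda>_. True) X Y f g"
  by (subst homotopic_with) (use assms in auto)

lemma openin_prod_discrete_topology:
  "openin (prod_topology (discrete_topology D) Y) W \<longleftrightarrow>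
    W \<subseteq> D \<times> topspace Y \<and> (\<forall>x\<in>D. openin Y {y. (x, y) \<in> W})"
proof safe
  assume W: "openin (prod_topology (discrete_topology D) Y) W"
  then have sub: "W \<subseteq> D \<times> topspace Y" using openin_subset by fastforce
  then show "\<And>a b. (a, b) \<in> W \<Longrightarrow> a \<in> D" "\<And>a b. (a, b) \<in> W \<Longrightarrow> b \<in> topspace Y" by auto
  fix x assume x: "x \<in> D"
  have "continuous_map Y (prod_topology (discrete_topology D) Y) (Pair x)"
    using x by (intro continuous_intros) auto
  from openin_continuous_map_preimage[OF this W]
  have "openin Y {y \<in> topspace Y. (x, y) \<in> W}" .
  moreover have "{y \<in> topspace Y. (x, y) \<in> W} = {y. (x, y) \<in> W}" using sub by auto
  ultimately show "openin Y {y. (x, y) \<in> W}" by simp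
next
  assume sub: "W \<subseteq> D \<times> topspace Y" and W: "\<forall>x\<in>D. openin Y {y. (x, y) \<in> W}"
  show "openin (prod_topology (discrete_topology D) Y) W"
    unfolding openin_prod_topology_alt
  proof (intro allI impI)
    fix x y assume xy: "(x, y) \<in> W"
    then have "x \<in> D" using sub by auto
    then show "\<exists>U V. openin (discrete_topology D) U \<and> openin Y V \<and> x \<in> U \<and> y \<in> V \<and> U \<times> V \<subseteq> W"
      using W xy by (intro exI[of _ "{x}"] exI[of _ "{y. (x, y) \<in> W}"]) auto
  qed
qed

section \<open>Nested families of events in an atomless space\<close>

text \<open>
  An atomless probability space contains a nested family of events with every probability. Take a
  maximal chain for strict inclusion with strict increase of the probability. The set of values of the
  probability on the chain is closed, since a monotone sequence of the chain can be completed
  by its limit; and it has no gaps, since a gap could be filled by splitting a difference.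
\<close>
lemma (in prob_space) ex_nested_events:
  assumes atomless: "atomless M"
  obtains T :: "real \<Rightarrow> 'a set" where
    "\<And>t. T t \<in> sets M" "\<And>s t. s \<le> t \<Longrightarrow> T s \<subseteq> T t" "T 0 = {}" "T 1 = space M"
    "\<And>t. 0 \<le> t \<Longrightarrow> t \<le> 1 \<Longrightarrow> prob (T t) = t"
proof -
  define P where "P A B \<longleftrightarrow> A \<subseteq> B \<and> prob A < prob B" for A B
  obtain \<C> where "pred_on.maxchain (sets M) P \<C>" using pred_on.Hausdorff by blast
  then have chain: "pred_on.chain (sets M) P \<C>"
    and max: "\<And>\<D>. pred_on.chain (sets M) P \<D> \<Longrightarrow> \<not> \<C> \<subset> \<D>"
    by (auto simp: pred_on.maxchain_def)
  have sets: "A \<in> sets M" if "A \<in> \<C>" for A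
    using chain that by (auto simp: pred_on.chain_def)
  have comparable: "A = B \<or> P A B \<or> P B A" if "A \<in> \<C>" "B \<in> \<C>" for A B
    using chain that by (auto simp: pred_on.chain_def)
  have nested: "A \<subseteq> B" if "A \<in> \<C>" "B \<in> \<C>" "prob A \<le> prob B" for A B
    using comparable[OF that(1,2)] that(3) by (auto simp: P_def)
  have maximal: "A \<in> \<C>" if A: "A \<in> sets M" "\<And>D. D \<in> \<C> \<Longrightarrow> D = A \<or> P A D \<or> P D A" for A
  proof (rule ccontr)
    assume "A \<notin> \<C>"
    moreover have "pred_on.chain (sets M) P (insert A \<C>)"
      using chain A unfolding pred_on.chain_def by auto
    ultimately show False using max by blast
  qed
  define V where "V = prob ` \<C>"
  have V_le: "0 \<le> v" "v \<le> 1" if "v \<in> V" for v using that by (auto simp: V_def)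
  \<comment> \<open>The empty set itself may be missing from the chain, being incomparable with null sets.\<close>
  have "0 \<in> V"
  proof (rule ccontr)
    assume "0 \<notin> V"
    then have "{} \<in> \<C>"
      by (intro maximal) (auto simp: V_def P_def zero_less_measure_iff image_iff measure_le_0_iff
          intro: antisym dest: sym)
    then show False using \<open>0 \<notin> V\<close> by (force simp: V_def)
  qed
  have "1 \<in> V"
  proof (rule ccontr)
    assume "1 \<notin> V"
    have "prob D < 1" "D \<subseteq> space M" if "D \<in> \<C>" for D
    proof -
      have "prob D \<noteq> 1" using \<open>1 \<notin> V\<close> that unfolding V_def by (metis imageI)
      then show "prob D < 1" using prob_le_1[of D] by linarith
      show "D \<subseteq> space M" using sets[OF that] by (rule sets.sets_into_space)
    qed
    then have "space M \<in> \<C>"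
      by (intro maximal) (auto simp: P_def prob_space)
    then show False using \<open>1 \<notin> V\<close> prob_space unfolding V_def by (metis imageI)
  qed
  have "closed V"
    unfolding closed_sequential_limits
  proof (intro allI impI, elim conjE)
    fix x v assume "\<forall>n. x n \<in> V" and lim: "x \<longlonglongrightarrow> v"
    then obtain C where C: "\<And>n. C n \<in> \<C>" "\<And>n. x n = prob (C n)"
      unfolding V_def image_iff Bex_def by metis
    obtain f :: "nat \<Rightarrow> nat" where f: "strict_mono f" "monoseq (\<lambda>n. x (f n))"
      using seq_monosub by blast
    define B where "B n = C (f n)" for n
    have B: "B n \<in> \<C>" for n by (simp add: B_def C)
    have limB: "(\<lambda>n. prob (B n)) \<longlonglongrightarrow> v"
      using LIMSEQ_subseq_LIMSEQ[OF lim f(1)] by (simp add: B_def C(2) comp_def)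
    have Bsets: "range B \<subseteq> sets M" using B sets by blast
    show "v \<in> V"
    proof (rule ccontr)
      assume v: "v \<notin> V"
      then have ne: "prob D \<noteq> v" if "D \<in> \<C>" for D using that by (auto simp: V_def)
      from f(2) consider "incseq (\<lambda>n. prob (B n))" | "decseq (\<lambda>n. prob (B n))"
        by (auto simp: monoseq_iff B_def C(2))
      then show False
      proof cases
        case 1
        let ?A = "\<Union>n. B n"
        have "incseq B" using 1 B nested by (auto simp: incseq_def)
        then have "(\<lambda>n. prob (B n)) \<longlonglongrightarrow> prob ?A" by (rule finite_Lim_measure_incseq[OF Bsets])
        then have A: "prob ?A = v" using limB LIMSEQ_unique by blast
        have le: "prob (B n) \<le> v" for n using incseq_le[OF 1 limB] .
        have "P ?A D \<or> P D ?A" if D: "D \<in> \<C>" for D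
        proof (cases "prob D < v")
          case True
          then obtain n where "prob D < prob (B n)"
            using order_tendstoD(1)[OF limB True] by (auto simp: eventually_sequentially)
          then have "D \<subseteq> B n" using nested[OF D B] by simp
          then show ?thesis using True A by (auto simp: P_def)
        next
          case False
          then have "v < prob D" using ne[OF D] by simp
          then have "B n \<subseteq> D" for n using nested[OF B D] le[of n] by force
          then show ?thesis using \<open>v < prob D\<close> A by (auto simp: P_def)
        qed
        then have "?A \<in> \<C>" using Bsets by (intro maximal sets.countable_UN) auto
        then show False using A v by (auto simp: V_def)
      next
        case 2
        let ?A = "\<Inter>n. B n"
        have "decseq B" using 2 B nested by (auto simp: decseq_def)
        then have "(\<lambda>n. prob (B n)) \<longlonglongrightarrow> prob ?A" by (rule finite_Lim_measure_decseq[OF Bsets])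
        then have A: "prob ?A = v" using limB LIMSEQ_unique by blast
        have le: "v \<le> prob (B n)" for n using decseq_ge[OF 2 limB] .
        have "P ?A D \<or> P D ?A" if D: "D \<in> \<C>" for D
        proof (cases "v < prob D")
          case True
          then obtain n where "prob (B n) < prob D"
            using order_tendstoD(2)[OF limB True] by (auto simp: eventually_sequentially)
          then have "B n \<subseteq> D" using nested[OF B D] by simp
          then show ?thesis using True A by (auto simp: P_def)
        next
          case False
          then have "prob D < v" using ne[OF D] by simp
          then have "D \<subseteq> B n" for n using nested[OF D B] le[of n] by force
          then show ?thesis using \<open>prob D < v\<close> A by (auto simp: P_def)
        qed
        then have "?A \<in> \<C>" using Bsets by (intro maximal sets.countable_INT) auto
        then show False using A v by (auto simp: V_def)
      qed
    qed
  qed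
  have full: "t \<in> V" if t: "0 \<le> t" "t \<le> 1" for t
  proof (rule ccontr)
    assume "t \<notin> V"
    define a b where "a = Sup (V \<inter> {..t})" and "b = Inf (V \<inter> {t..})"
    have "a \<in> V \<inter> {..t}" unfolding a_def
      by (rule closed_contains_Sup) (use \<open>closed V\<close> \<open>0 \<in> V\<close> t in auto)
    moreover have "b \<in> V \<inter> {t..}" unfolding b_def
      by (rule closed_contains_Inf) (use \<open>closed V\<close> \<open>1 \<in> V\<close> t in auto)
    ultimately obtain A B where AB: "A \<in> \<C>" "B \<in> \<C>" "prob A = a" "prob B = b" "a < t" "t < b"
      using \<open>t \<notin> V\<close> by (auto simp: V_def less_le)
    have gap: "prob D \<le> a \<or> b \<le> prob D" if "D \<in> \<C>" for D
    proof (cases "prob D \<le> t")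
      case True
      then have "prob D \<le> a" unfolding a_def
        using that by (intro cSup_upper) (auto simp: V_def intro!: bdd_aboveI[of _ t])
      then show ?thesis ..
    next
      case False
      then have "b \<le> prob D" unfolding b_def
        using that by (intro cInf_lower) (auto simp: V_def intro!: bdd_belowI[of _ t])
      then show ?thesis ..
    qed
    have "A \<subseteq> B" using nested AB by auto
    have diff: "prob (B - A) = b - a"
      using AB sets \<open>A \<subseteq> B\<close> by (simp add: finite_measure_Diff)
    then obtain C where C: "C \<in> sets M" "C \<subseteq> B - A" "0 < prob C" "prob C < b - a"
      using atomless AB(1,2,5,6) sets unfolding atomless_def by (force dest: bspec[of _ _ "B - A"])
    have AC: "prob (A \<union> C) = a + prob C"
      using C AB sets by (subst finite_measure_Union) auto
    have "P (A \<union> C) D \<or> P D (A \<union> C)" if D: "D \<in> \<C>" for D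
      using gap[OF D]
    proof
      assume "prob D \<le> a"
      then show ?thesis using nested[OF D AB(1)] AB(3) AC C(3) by (auto simp: P_def)
    next
      assume "b \<le> prob D"
      then show ?thesis using nested[OF AB(2) D] \<open>A \<subseteq> B\<close> AB(4) AC C by (auto simp: P_def)
    qed
    then have "A \<union> C \<in> \<C>" using AB C sets by (intro maximal) auto
    then show False using gap[of "A \<union> C"] AC C by auto
  qed
  then have "\<forall>t. \<exists>A. 0 \<le> t \<and> t \<le> 1 \<longrightarrow> A \<in> \<C> \<and> prob A = t"
    unfolding V_def by (metis imageE)
  then obtain E where E: "\<And>t. 0 \<le> t \<Longrightarrow> t \<le> 1 \<Longrightarrow> E t \<in> \<C>" "\<And>t. 0 \<le> t \<Longrightarrow> t \<le> 1 \<Longrightarrow> prob (E t) = t"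
    by metis
  define T where "T t = (if t \<le> 0 then {} else if t < 1 then E t else space M)" for t
  show thesis
  proof
    show "T t \<in> sets M" for t using E(1) sets by (auto simp: T_def)
    show "T s \<subseteq> T t" if "s \<le> t" for s t
      using that E(2) nested[OF E(1) E(1), of s t] sets[OF E(1), THEN sets.sets_into_space]
      by (auto simp: T_def)
    show "T 0 = {}" "T 1 = space M" by (auto simp: T_def)
    show "prob (T t) = t" if "0 \<le> t" "t \<le> 1" for t
      using that E(2)[OF that] prob_space by (auto simp: T_def)
  qed
qed

section \<open>Random variables up to null sets\<close>

locale complete_prob_space = prob_space M + complete_measure M for M :: "'w measure"
begin

lemma sets_eq_random_var:
  assumes "f \<in> random_vars M S"
  shows "f -` {s} \<inter> space M \<in> sets M"
proof (cases "s \<in> S")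
  case True
  then show ?thesis using assms measurable_sets[of f M "count_space S" "{s}"]
    by (simp add: random_vars_def)
next
  case False
  then have "f -` {s} \<inter> space M = {}"
    using assms measurable_space[of f M "count_space S"] by (auto simp: random_vars_def)
  then show ?thesis by simp
qed

lemma sets_neq: "f \<in> random_vars M S \<Longrightarrow> g \<in> random_vars M S \<Longrightarrow> {t \<in> space M. f t \<noteq> g t} \<in> sets M"
  using complete_measure_axioms by (rule sets_neq_random_vars)

lemma random_vars_compose:
  assumes f: "f \<in> random_vars M R" and h: "h \<in> R \<rightarrow> S"
  shows "h \<circ> f \<in> random_vars M S"
proof -
  obtain C where "countable C" "AE t in M. f t \<in> C"
    using f by (auto simp: random_vars_def)
  then have "countable (h ` C)" "AE t in M. (h \<circ> f) t \<in> h ` C"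
    by (auto elim: eventually_mono)
  moreover have "h \<circ> f \<in> measurable M (count_space S)"
    using f h by (intro measurable_comp[of f M "count_space R"]) (auto simp: random_vars_def)
  ultimately show ?thesis unfolding random_vars_def by blast
qed

lemma random_vars_If:
  assumes f: "f \<in> random_vars M S" and g: "g \<in> random_vars M S" and A: "A \<in> sets M"
  shows "(\<lambda>t. if t \<in> A then f t else g t) \<in> random_vars M S"
proof -
  obtain C D where CD: "countable C" "AE t in M. f t \<in> C" "countable D" "AE t in M. g t \<in> D"
    using f g by (auto simp: random_vars_def)
  from CD(2,4) have "AE t in M. (if t \<in> A then f t else g t) \<in> C \<union> D" by eventually_elim auto
  moreover have "countable (C \<union> D)" using CD by simp
  moreover have "(\<lambda>t. if t \<in> A then f t else g t) \<in> measurable M (count_space S)"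
    using f g A by (intro measurable_If_set) (auto simp: random_vars_def)
  ultimately show ?thesis unfolding random_vars_def by blast
qed

lemma random_vars_finite:
  assumes F: "finite F" "F \<subseteq> S" and f: "\<And>t. t \<in> space M \<Longrightarrow> f t \<in> F"
    and meas: "\<And>s. s \<in> F \<Longrightarrow> f -` {s} \<inter> space M \<in> sets M"
  shows "f \<in> random_vars M S"
proof -
  have "f -` A \<inter> space M \<in> sets M" for A
  proof -
    have "f -` A \<inter> space M = (\<Union>s\<in>A \<inter> F. f -` {s} \<inter> space M)" using f by auto
    also have "\<dots> \<in> sets M" using F meas by (intro sets.finite_UN) auto
    finally show ?thesis .
  qed
  then have "f \<in> measurable M (count_space S)"
    using f F by (auto simp: measurable_def)
  moreover have "AE t in M. f t \<in> F" using f by (intro AE_I2)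
  moreover have "countable F" using F by (simp add: countable_finite)
  ultimately show ?thesis unfolding random_vars_def by blast
qed

lemma AE_essential_image:
  assumes f: "f \<in> random_vars M S"
  shows "AE t in M. f t \<in> essential_image M f"
proof -
  obtain C where C: "countable C" "AE t in M. f t \<in> C"
    using f by (auto simp: random_vars_def)
  have "AE t in M. f t \<noteq> c" if "c \<in> C - essential_image M f" for c
  proof -
    have "prob (f -` {c} \<inter> space M) = 0"
      using that measure_nonneg[of M "f -` {c} \<inter> space M"]
      by (auto simp: essential_image_def not_less intro: antisym)
    then have "AE t in M. t \<notin> f -` {c} \<inter> space M"
      using prob_eq_0[OF sets_eq_random_var[OF f]] by blast
    with AE_space show ?thesis by eventually_elim auto
  qed
  then have "AE t in M. \<forall>c\<in>C - essential_image M f. f t \<noteq> c"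
    using C(1) by (subst AE_ball_countable) (auto intro: countable_Diff)
  with C(2) show ?thesis by eventually_elim auto
qed

lemma essential_image_cong:
  assumes "f \<in> random_vars M S" "g \<in> random_vars M S" "AE t in M. f t = g t"
  shows "essential_image M f = essential_image M g"
proof -
  have "prob (f -` {s} \<inter> space M) = prob (g -` {s} \<inter> space M)" for s
    using assms(3) sets_eq_random_var[OF assms(1)] sets_eq_random_var[OF assms(2)]
    by (intro finite_measure_eq_AE) auto
  then show ?thesis by (simp add: essential_image_def)
qed

lemma essential_image_subset_range:
  "f \<in> space M \<rightarrow> R \<Longrightarrow> essential_image M f \<subseteq> R"
proof
  fix s assume "f \<in> space M \<rightarrow> R" "s \<in> essential_image M f"
  then have "f -` {s} \<inter> space M \<noteq> {}" by (auto simp: essential_image_def)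
  then show "s \<in> R" using \<open>f \<in> _\<close> by auto
qed

lemma essential_image_subset:
  assumes f: "f \<in> random_vars M S" and R: "AE t in M. f t \<in> R"
  shows "essential_image M f \<subseteq> R"
proof
  fix s assume s: "s \<in> essential_image M f"
  show "s \<in> R"
  proof (rule ccontr)
    assume "s \<notin> R"
    with R have "AE t in M. t \<notin> f -` {s} \<inter> space M" by (auto elim: eventually_mono)
    then have "prob (f -` {s} \<inter> space M) = 0" using prob_eq_0[OF sets_eq_random_var[OF f]] by blast
    then show False using s by (simp add: essential_image_def)
  qed
qed

lemma ae_class_in_Lone: "f \<in> random_vars M S \<Longrightarrow> ae_class M S f \<in> Lone M S"
  by (simp add: Lone_def)

lemma Lone_eqI:
  assumes "A \<in> Lone M S" "B \<in> Lone M S" "AE t in M. rv_rep A t = rv_rep B t"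
  shows "A = B"
  using ae_class_eq_iff[OF rv_rep_in(1)[OF assms(1)] rv_rep_in(1)[OF assms(2)]] assms
  by (simp add: rv_rep_in(2))

lemma ae_class_eqI:
  assumes "f \<in> random_vars M S" "A \<in> Lone M S" "AE t in M. f t = rv_rep A t"
  shows "ae_class M S f = A"
  using ae_class_eq_iff[OF assms(1) rv_rep_in(1)[OF assms(2)]] assms(3) rv_rep_in(2)[OF assms(2)]
  by simp

lemma Lone_dist_ae_class:
  assumes f: "f \<in> random_vars M S" and g: "g \<in> random_vars M S"
  shows "Lone_dist M (ae_class M S f) (ae_class M S g) = prob {t \<in> space M. f t \<noteq> g t}"
  unfolding Lone_dist_eq_measure
proof (rule finite_measure_eq_AE)
  show "AE t in M. (t \<in> {t \<in> space M. rv_rep (ae_class M S f) t \<noteq> rv_rep (ae_class M S g) t}) =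
      (t \<in> {t \<in> space M. f t \<noteq> g t})"
    using rv_rep_ae_class[OF f] rv_rep_ae_class[OF g] by eventually_elim simp
qed (use f g in \<open>auto intro!: sets_neq rv_rep_in(1) ae_class_in_Lone\<close>)

lemma prob_eq_le_dist:
  assumes A: "A \<in> Lone M S" and B: "B \<in> Lone M S"
  shows "\<bar>prob (rv_rep A -` {s} \<inter> space M) - prob (rv_rep B -` {s} \<inter> space M)\<bar> \<le> Lone_dist M A B"
proof -
  have *: "prob (f -` {s} \<inter> space M) \<le> prob (g -` {s} \<inter> space M) + prob {t \<in> space M. f t \<noteq> g t}"
    if fg: "f \<in> random_vars M S" "g \<in> random_vars M S" for f g
  proof -
    have "prob (f -` {s} \<inter> space M) \<le> prob ((g -` {s} \<inter> space M) \<union> {t \<in> space M. f t \<noteq> g t})"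
      using fg by (intro finite_measure_mono) (auto intro: sets_eq_random_var sets_neq)
    also have "\<dots> \<le> prob (g -` {s} \<inter> space M) + prob {t \<in> space M. f t \<noteq> g t}"
      using fg by (intro measure_Un_le) (auto intro: sets_eq_random_var sets_neq)
    finally show ?thesis .
  qed
  have "{t \<in> space M. rv_rep B t \<noteq> rv_rep A t} = {t \<in> space M. rv_rep A t \<noteq> rv_rep B t}" by auto
  then show ?thesis
    using *[OF rv_rep_in(1)[OF A] rv_rep_in(1)[OF B]] *[OF rv_rep_in(1)[OF B] rv_rep_in(1)[OF A]]
    by (simp add: Lone_dist_eq_measure abs_le_iff)
qed

end


section \<open>Finitely supported probability mass functions\<close>

lemma pmf_embed_finite:
  fixes w :: "'s \<Rightarrow> real"
  assumes "finite E" and "\<And>s. 0 \<le> w s" and "\<And>s. s \<notin> E \<Longrightarrow> w s = 0" and "sum w E = 1"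
  shows "pmf (embed_pmf w) s = w s"
proof (rule pmf_embed_pmf)
  have "(\<integral>\<^sup>+ x. ennreal (w x) \<partial>count_space UNIV) = (\<Sum>x\<in>E. ennreal (w x))"
    using assms by (intro nn_integral_count_space') auto
  also have "\<dots> = ennreal (sum w E)" using assms by simp
  finally show "(\<integral>\<^sup>+ x. ennreal (w x) \<partial>count_space UNIV) = 1" using assms(4) by simp
qed (use assms in auto)

text \<open>The largest probability of a point.\<close>
definition pmf_height :: "'s pmf \<Rightarrow> real" where
  "pmf_height p = (SUP s. pmf p s)"

lemma pmf_le_height: "pmf p s \<le> pmf_height p"
  unfolding pmf_height_def by (intro cSUP_upper bdd_aboveI2[of _ _ 1]) (auto simp: pmf_le_1)

lemma pmf_height_pos: "0 < pmf_height p"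
proof -
  obtain s where "s \<in> set_pmf p" using set_pmf_not_empty by fast
  then have "0 < pmf p s" by (rule pmf_positive)
  also have "\<dots> \<le> pmf_height p" by (rule pmf_le_height)
  finally show ?thesis .
qed

lemma pmf_height_Lipschitz:
  assumes "\<And>s. \<bar>pmf p s - pmf q s\<bar> \<le> e"
  shows "\<bar>pmf_height p - pmf_height q\<bar> \<le> e"
proof -
  have "pmf_height p \<le> pmf_height q + e" if "\<And>s. \<bar>pmf p s - pmf q s\<bar> \<le> e" for p q :: "'a pmf"
    unfolding pmf_height_def[of p]
  proof (rule cSUP_least)
    show "pmf p s \<le> pmf_height q + e" for s
      using that[of s] pmf_le_height[of q s] by linarith
  qed simp
  from this[of p q] this[of q p] show ?thesis using assms by (auto simp: abs_minus_commute abs_le_iff)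
qed

lemma pmf_height_closed_simplex:
  assumes "p \<in> closed_simplex F" "finite F" 
  shows "pmf_height p = Max (pmf p ` F)"
proof (rule antisym)
  have ne: "F \<noteq> {}" using assms set_pmf_not_empty[of p] by (auto simp: closed_simplex_def)
  show "Max (pmf p ` F) \<le> pmf_height p"
    using assms ne by (auto intro: pmf_le_height)
  have nonneg: "0 \<le> Max (pmf p ` F)" using assms ne by (auto simp: Max_ge_iff)
  show "pmf_height p \<le> Max (pmf p ` F)"
    unfolding pmf_height_def
  proof (rule cSUP_least)
    show "pmf p s \<le> Max (pmf p ` F)" for s
    proof (cases "s \<in> F")
      case False
      then have "pmf p s = 0" using assms by (auto simp: closed_simplex_def pmf_eq_0_set_pmf)
      then show ?thesis using nonneg by simp
    qed (use assms in auto)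
  qed simp
qed

text \<open>
  Lowering all weights by the same amount and rescaling: points of small probability are removed
  from the support. At time \<open>0\<close> nothing happens; at time \<open>1\<close> exactly the points with more
  than half of the largest probability survive.
\<close>
definition shrink :: "real \<Rightarrow> 's pmf \<Rightarrow> 's pmf" where
  "shrink t p = embed_pmf (\<lambda>s. max 0 (pmf p s - t * pmf_height p / 2) /
    (\<Sum>r\<in>set_pmf p. max 0 (pmf p r - t * pmf_height p / 2)))"

lemma shrink_total_pos:
  assumes "finite F" "set_pmf p \<subseteq> F" "t \<le> 1"
  shows "0 < (\<Sum>r\<in>F. max 0 (pmf p r - t * pmf_height p / 2))"
proof -
  have "pmf_height p / 2 < pmf_height p" using pmf_height_pos[of p] by simp
  then obtain s where s: "pmf_height p / 2 < pmf p s"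
    unfolding pmf_height_def[of p]
    by (subst (asm) less_cSUP_iff) (auto intro!: bdd_aboveI2[of _ _ 1] simp: pmf_le_1)
  have "t * pmf_height p \<le> 1 * pmf_height p"
    using assms(3) pmf_height_pos[of p] by (intro mult_right_mono) auto
  then have "0 < max 0 (pmf p s - t * pmf_height p / 2)" using s by simp
  moreover have "0 < pmf p s" using s pmf_height_pos[of p] by simp
  then have "s \<in> F" using assms(2) by (auto simp: set_pmf_iff)
  ultimately show ?thesis using assms(1) by (intro sum_pos2[of F s]) auto
qed

lemma pmf_shrink:
  assumes "finite F" "set_pmf p \<subseteq> F" "0 \<le> t" "t \<le> 1"
  shows "pmf (shrink t p) s =
    max 0 (pmf p s - t * pmf_height p / 2) / (\<Sum>r\<in>F. max 0 (pmf p r - t * pmf_height p / 2))"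
proof -
  let ?w = "\<lambda>s. max 0 (pmf p s - t * pmf_height p / 2)"
  have out: "?w s = 0" if "s \<notin> set_pmf p" for s
    using that assms(3) pmf_height_pos[of p] by (simp add: set_pmf_iff)
  have eq: "sum ?w (set_pmf p) = sum ?w F"
    using assms out by (intro sum.mono_neutral_left) auto
  have "pmf (shrink t p) s = ?w s / sum ?w (set_pmf p)"
    unfolding shrink_def
  proof (rule pmf_embed_finite[where E = F])
    show "(\<Sum>s\<in>F. ?w s / sum ?w (set_pmf p)) = 1"
      using shrink_total_pos[OF assms(1,2,4)] by (simp add: eq flip: sum_divide_distrib)
    show "?w s / sum ?w (set_pmf p) = 0" if "s \<notin> F" for s
      using out[of s] that assms(2) by auto
  qed (use assms in \<open>auto intro!: divide_nonneg_nonneg sum_nonneg\<close>)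
  then show ?thesis by (simp add: eq)
qed

lemma set_pmf_shrink:
  assumes "finite (set_pmf p)" "0 \<le> t" "t \<le> 1"
  shows "set_pmf (shrink t p) = {s. t * pmf_height p / 2 < pmf p s}"
  using shrink_total_pos[OF assms(1) order_refl assms(3)]
  by (auto simp: set_pmf_iff pmf_shrink[OF assms(1) order_refl assms(2,3)])

lemma set_pmf_shrink_subset:
  assumes "finite (set_pmf p)" "0 \<le> t" "t \<le> 1"
  shows "set_pmf (shrink t p) \<subseteq> set_pmf p"
proof
  fix s assume "s \<in> set_pmf (shrink t p)"
  then have "t * pmf_height p / 2 < pmf p s" by (simp add: set_pmf_shrink[OF assms])
  moreover have "0 \<le> t * pmf_height p / 2" using assms pmf_height_pos[of p] by simp
  ultimately show "s \<in> set_pmf p" by (simp add: set_pmf_iff)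
qed

lemma shrink_0:
  assumes "finite (set_pmf p)"
  shows "shrink 0 p = p"
proof (rule pmf_eqI)
  show "pmf (shrink 0 p) s = pmf p s" for s
    using sum_pmf_eq_1[OF assms order_refl] by (simp add: pmf_shrink[OF assms order_refl])
qed

lemma continuous_map_into_simplex_topology:
  "continuous_map X (simplex_topology F) f \<longleftrightarrow>
    f \<in> topspace X \<rightarrow> closed_simplex F \<and> (\<forall>s. continuous_map X euclideanreal (\<lambda>x. pmf (f x) s))"
proof -
  have "continuous_map X (simplex_topology F) f \<longleftrightarrow>
      continuous_map X euclidean (pmf \<circ> f) \<and> f \<in> topspace X \<rightarrow> closed_simplex F"
  proof safe
    assume f: "continuous_map X (simplex_topology F) f"
    have "continuous_map (simplex_topology F) euclidean (id \<circ> pmf)"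
      unfolding simplex_topology_def by (rule continuous_map_pullback) simp
    from continuous_map_compose[OF f this] show "continuous_map X euclidean (pmf \<circ> f)" by simp
    show "x \<in> topspace X \<Longrightarrow> f x \<in> closed_simplex F" for x
      using continuous_map_funspace[OF f] by auto
  next
    assume "continuous_map X euclidean (pmf \<circ> f)" "f \<in> topspace X \<rightarrow> closed_simplex F"
    then show "continuous_map X (simplex_topology F) f"
      unfolding simplex_topology_def by (intro continuous_map_pullback') auto
  qed
  also have "continuous_map X euclidean (pmf \<circ> f) \<longleftrightarrow>
      (\<forall>s. continuous_map X euclideanreal (\<lambda>x. pmf (f x) s))"
    by (simp add: euclidean_product_topology[symmetric] continuous_map_componentwise_UNIV comp_def)
  finally show ?thesis by blast
qed

lemma continuous_map_pmf:
  "continuous_map (simplex_topology F) euclideanreal (\<lambda>p. pmf p s)"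
  using continuous_map_into_simplex_topology[of "simplex_topology F" F id] by auto

lemma continuous_map_Max:
  fixes g :: "'i \<Rightarrow> 'a \<Rightarrow> real"
  assumes "finite F" "F \<noteq> {}" "\<And>s. s \<in> F \<Longrightarrow> continuous_map X euclideanreal (g s)"
  shows "continuous_map X euclideanreal (\<lambda>x. Max ((\<lambda>s. g s x) ` F))"
  using assms
proof (induction F rule: finite_ne_induct)
  case (insert s F)
  then have "(\<lambda>x. Max ((\<lambda>r. g r x) ` insert s F)) = (\<lambda>x. max (g s x) (Max ((\<lambda>r. g r x) ` F)))"
    by (simp add: fun_eq_iff)
  moreover have "continuous_map X euclideanreal (\<lambda>x. max (g s x) (Max ((\<lambda>r. g r x) ` F)))"
    using insert by (intro continuous_map_real_max) auto
  ultimately show ?case by (simp only:)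
qed auto

lemma continuous_map_pmf_height:
  assumes "finite F"
  shows "continuous_map (simplex_topology F) euclideanreal pmf_height"
proof (cases "F = {}")
  case True
  then have "topspace (simplex_topology F) = {}" by (simp add: closed_simplex_def set_pmf_not_empty)
  then show ?thesis by (simp add: continuous_map_def)
next
  case False
  then have "continuous_map (simplex_topology F) euclideanreal (\<lambda>p. Max (pmf p ` F))"
    using assms by (intro continuous_map_Max continuous_map_pmf)
  then show ?thesis
    by (rule continuous_map_eq) (simp add: pmf_height_closed_simplex assms)
qed

text \<open>
  The heights and the single weights being continuous, shrinking is continuous as long as the
  shrunk probability mass functions stay in one simplex; the original ones need not do so.
\<close>
lemma continuous_map_shrink:
  assumes F: "finite F" and P: "\<And>x. x \<in> topspace X \<Longrightarrow> finite (set_pmf (P x))"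
    and sub: "\<And>x. x \<in> topspace X \<Longrightarrow> set_pmf (shrink (\<tau> x) (P x)) \<subseteq> F"
    and \<tau>: "continuous_map X euclideanreal \<tau>" "\<tau> \<in> topspace X \<rightarrow> {0..1}"
    and P_cont: "\<And>s. continuous_map X euclideanreal (\<lambda>x. pmf (P x) s)"
      "continuous_map X euclideanreal (\<lambda>x. pmf_height (P x))"
  shows "continuous_map X (simplex_topology F) (\<lambda>x. shrink (\<tau> x) (P x))"
  unfolding continuous_map_into_simplex_topology
proof (intro conjI allI)
  show "(\<lambda>x. shrink (\<tau> x) (P x)) \<in> topspace X \<rightarrow> closed_simplex F"
    using sub by (auto simp: closed_simplex_def)
  fix s
  let ?w = "\<lambda>x s. max 0 (pmf (P x) s - \<tau> x * pmf_height (P x) / 2)"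
  have \<tau>01: "0 \<le> \<tau> x" "\<tau> x \<le> 1" if "x \<in> topspace X" for x
    using \<tau>(2) that by (auto simp: Pi_iff)
  have eq: "sum (?w x) (set_pmf (P x)) = sum (?w x) F" if x: "x \<in> topspace X" for x
  proof -
    let ?G = "set_pmf (P x) \<union> F"
    have "?w x r = 0" if "r \<in> ?G - F" for r
    proof -
      have "r \<notin> set_pmf (shrink (\<tau> x) (P x))" using that sub[OF x] by blast
      then show ?thesis using set_pmf_shrink[OF P[OF x] \<tau>01[OF x]] by simp
    qed
    then have "sum (?w x) F = sum (?w x) ?G"
      using F P[OF x] by (intro sum.mono_neutral_left) auto
    moreover have "?w x r = 0" if "r \<in> ?G - set_pmf (P x)" for r
      using that \<tau>01[OF x] pmf_height_pos[of "P x"] by (simp add: set_pmf_iff)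
    then have "sum (?w x) (set_pmf (P x)) = sum (?w x) ?G"
      using F P[OF x] by (intro sum.mono_neutral_left) auto
    ultimately show ?thesis by simp
  qed
  have w: "continuous_map X euclideanreal (\<lambda>x. ?w x s)" for s
    by (intro continuous_intros continuous_map_real_max continuous_map_diff continuous_map_real_divide
        continuous_map_real_mult \<tau> P_cont) auto
  have "continuous_map X euclideanreal (\<lambda>x. ?w x s / sum (?w x) F)"
  proof (intro continuous_map_real_divide continuous_map_sum w F)
    show "sum (?w x) F \<noteq> 0" if "x \<in> topspace X" for x
      using shrink_total_pos[OF P[OF that] order_refl \<tau>01(2)[OF that]] eq[OF that] by simp
  qed
  then show "continuous_map X euclideanreal (\<lambda>x. pmf (shrink (\<tau> x) (P x)) s)"
    by (rule continuous_map_eq)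
      (simp add: pmf_shrink[OF P order_refl \<tau>01] eq)
qed


section \<open>Random simplices: laws, quantiles and mixtures\<close>

text \<open>
  A simplicial complex with vertices in a linearly ordered type, together with a nested family of
  events \<open>T t\<close> of probability \<open>t\<close>. That \<open>T 0\<close> and \<open>T 1\<close> are the empty set and the whole space
  exactly, and not up to null sets, makes the quantile functions below defined at every point and
  their level sets exact.
\<close>
locale random_simplices = complete_prob_space M for M :: "'w measure" +
  fixes T :: "real \<Rightarrow> 'w set" and S :: "'s::linorder set" and K :: "'s set set"
  assumes T_sets: "\<And>t. T t \<in> sets M"
    and T_mono: "\<And>s t. s \<le> t \<Longrightarrow> T s \<subseteq> T t"
    and T_0: "T 0 = {}" and T_1: "T 1 = space M"
    and prob_T: "\<And>t. 0 \<le> t \<Longrightarrow> t \<le> 1 \<Longrightarrow> prob (T t) = t"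
    and complex: "simplicial_complex_over S K"
begin

lemma face_finite: "F \<in> K \<Longrightarrow> finite F" and face_nonempty: "F \<in> K \<Longrightarrow> F \<noteq> {}"
  and face_subset: "F \<in> K \<Longrightarrow> F \<subseteq> S"
  and face_closed: "F \<in> K \<Longrightarrow> G \<subseteq> F \<Longrightarrow> G \<noteq> {} \<Longrightarrow> G \<in> K"
  using complex unfolding simplicial_complex_over_def by blast+

text \<open>
  The essential image of a class; by \<open>support_ae_class\<close> below it does not depend on the representative.
\<close>
definition support :: "('w \<Rightarrow> 's) set \<Rightarrow> 's set" where
  "support A = essential_image M (rv_rep A)"

text \<open>The underlying set of \<open>L(K)\<close>.\<close>
definition Lset :: "('w \<Rightarrow> 's) set set" where
  "Lset = ae_class M S ` {f \<in> random_vars M S. essential_image M f \<in> K}"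

lemma support_ae_class: "f \<in> random_vars M S \<Longrightarrow> support (ae_class M S f) = essential_image M f"
  unfolding support_def
  by (rule essential_image_cong[of _ S]) (auto intro: rv_rep_in(1) ae_class_in_Lone rv_rep_ae_class)

lemma Lset_iff: "A \<in> Lset \<longleftrightarrow> A \<in> Lone M S \<and> support A \<in> K"
proof
  assume "A \<in> Lset"
  then show "A \<in> Lone M S \<and> support A \<in> K"
    by (auto simp: Lset_def support_ae_class intro: ae_class_in_Lone)
next
  assume "A \<in> Lone M S \<and> support A \<in> K"
  then show "A \<in> Lset"
    using rv_rep_in[of A M S] unfolding Lset_def support_def by (metis (mono_tags, lifting) image_eqI mem_Collect_eq)
qed

lemma Lset_Lone: "A \<in> Lset \<Longrightarrow> A \<in> Lone M S" by (simp add: Lset_iff)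

lemma Lset_rv: "A \<in> Lset \<Longrightarrow> rv_rep A \<in> random_vars M S" by (simp add: Lset_iff rv_rep_in)

lemma AE_support: "A \<in> Lset \<Longrightarrow> AE t in M. rv_rep A t \<in> support A"
  unfolding support_def by (rule AE_essential_image[OF Lset_rv])

lemma Metric_space_Lset: "Metric_space Lset (Lone_dist M)"
proof -
  interpret L: Metric_space "Lone M S" "Lone_dist M"
    by (rule Metric_space_Lone) (unfold_locales)
  show ?thesis by (rule L.subspace) (auto simp: Lset_iff)
qed

interpretation L: Metric_space Lset "Lone_dist M"
  by (rule Metric_space_Lset)

lemma complex_L_eq: "complex_L M S K = L.mtopology"
  by (simp add: complex_L_def Lset_def)

lemma topspace_complex_L [simp]: "topspace (complex_L M S K) = Lset"
  by (simp add: complex_L_eq)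

text \<open>
  The distribution of a random variable with finite essential image, as a point of the
  geometric realization.
\<close>
definition law :: "('w \<Rightarrow> 's) set \<Rightarrow> 's pmf" where
  "law A = embed_pmf (\<lambda>s. prob (rv_rep A -` {s} \<inter> space M))"

lemma pmf_law:
  assumes A: "A \<in> Lset"
  shows "pmf (law A) s = prob (rv_rep A -` {s} \<inter> space M)"
  unfolding law_def
proof (rule pmf_embed_finite[where E = "support A"])
  show fin: "finite (support A)" using A by (simp add: Lset_iff face_finite)
  show "prob (rv_rep A -` {s} \<inter> space M) = 0" if "s \<notin> support A" for s
    using that measure_nonneg[of M "rv_rep A -` {s} \<inter> space M"]
    by (auto simp: support_def essential_image_def)
  have "(\<Sum>s\<in>support A. prob (rv_rep A -` {s} \<inter> space M)) =
      prob (\<Union>s\<in>support A. rv_rep A -` {s} \<inter> space M)"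
    using fin sets_eq_random_var[OF Lset_rv[OF A]]
    by (intro finite_measure_finite_Union[symmetric]) (auto simp: disjoint_family_on_def)
  also have "\<dots> = 1"
  proof -
    have "(\<Union>s\<in>support A. rv_rep A -` {s} \<inter> space M) \<in> sets M"
      using fin sets_eq_random_var[OF Lset_rv[OF A]] by (rule sets.finite_UN)
    moreover have "AE t in M. t \<in> (\<Union>s\<in>support A. rv_rep A -` {s} \<inter> space M)"
      using AE_support[OF A] AE_space by eventually_elim auto
    ultimately show ?thesis by (simp only: prob_eq_1)
  qed
  finally show "(\<Sum>s\<in>support A. prob (rv_rep A -` {s} \<inter> space M)) = 1" .
qed auto

lemma set_pmf_law: "A \<in> Lset \<Longrightarrow> set_pmf (law A) = support A"
  by (auto simp: set_pmf_iff pmf_law support_def essential_image_def zero_less_measure_iff)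

lemma law_Lipschitz:
  "A \<in> Lset \<Longrightarrow> B \<in> Lset \<Longrightarrow> \<bar>pmf (law A) s - pmf (law B) s\<bar> \<le> Lone_dist M A B"
  by (simp add: pmf_law prob_eq_le_dist[OF Lset_Lone Lset_Lone])

abbreviation cdf :: "'s pmf \<Rightarrow> 's \<Rightarrow> real" where
  "cdf p s \<equiv> measure (measure_pmf p) {..s}"

text \<open>
  The quantile function of \<open>p\<close>: its level set \<open>{t. quantile p t \<le> s}\<close> is the event of the nested
  family with probability \<open>cdf p s\<close>, so that its law is \<open>p\<close>.
\<close>
definition quantile :: "'s pmf \<Rightarrow> 'w \<Rightarrow> 's" where
  "quantile p t = Min {s \<in> set_pmf p. t \<in> T (cdf p s)}"

lemma quantile:
  assumes fin: "finite (set_pmf p)" and t: "t \<in> space M"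
  shows quantile_in: "quantile p t \<in> set_pmf p"
    and quantile_le_iff: "quantile p t \<le> s \<longleftrightarrow> t \<in> T (cdf p s)"
proof -
  let ?X = "{s \<in> set_pmf p. t \<in> T (cdf p s)}"
  have mono: "cdf p r \<le> cdf p s" if "r \<le> s" for r s
    using that by (intro measure_pmf.finite_measure_mono) auto
  have "cdf p (Max (set_pmf p)) = 1"
    using fin by (subst measure_pmf.prob_eq_1) (auto simp: AE_measure_pmf_iff)
  then have "Max (set_pmf p) \<in> ?X"
    using fin t T_1 Max_in[OF fin set_pmf_not_empty] by simp
  then have X: "finite ?X" "?X \<noteq> {}" using fin by auto
  then have min: "quantile p t \<in> ?X" unfolding quantile_def by (intro Min_in)
  then show "quantile p t \<in> set_pmf p" by simp
  show "quantile p t \<le> s \<longleftrightarrow> t \<in> T (cdf p s)"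
  proof
    assume "quantile p t \<le> s"
    then show "t \<in> T (cdf p s)" using min T_mono[OF mono] by blast
  next
    assume s: "t \<in> T (cdf p s)"
    let ?R = "{..s} \<inter> set_pmf p"
    have R: "?R \<noteq> {}"
    proof
      assume "?R = {}"
      then have "cdf p s = 0" using measure_Int_set_pmf[of p "{..s}"] by simp
      then show False using s T_0 by simp
    qed
    have fR: "finite ?R" using fin by blast
    have "Max ?R \<in> ?R" by (rule Max_in[OF fR R])
    moreover have "{..Max ?R} \<inter> set_pmf p = ?R"
    proof safe
      fix x assume "x \<in> set_pmf p" "x \<le> Max ?R"
      then show "x \<le> s" using \<open>Max ?R \<in> ?R\<close> by auto
    next
      fix x assume "x \<in> set_pmf p" "x \<le> s"
      then show "x \<le> Max ?R" using fR by auto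
    qed
    then have "cdf p (Max ?R) = cdf p s"
      using measure_Int_set_pmf[of p "{..s}"] measure_Int_set_pmf[of p "{..Max ?R}"] by simp
    ultimately have "Max ?R \<in> ?X" "Max ?R \<le> s" using s by auto
    then have "quantile p t \<le> Max ?R" unfolding quantile_def using X by (intro Min_le) auto
    then show "quantile p t \<le> s" using \<open>Max ?R \<le> s\<close> by simp
  qed
qed

lemma quantile_eq_set:
  assumes fin: "finite (set_pmf p)"
  shows "quantile p -` {s} \<inter> space M = T (cdf p s) - T (measure (measure_pmf p) {..<s})"
proof -
  let ?R = "{..<s} \<inter> set_pmf p"
  have sub: "T u \<subseteq> space M" for u using T_sets sets.sets_into_space by blast
  have "quantile p t < s \<longleftrightarrow> t \<in> T (measure (measure_pmf p) {..<s})" if t: "t \<in> space M" for t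
  proof (cases "?R = {}")
    case True
    then have "measure (measure_pmf p) {..<s} = 0" using measure_Int_set_pmf[of p "{..<s}"] by simp
    then show ?thesis using True quantile_in[OF fin t] T_0 by auto
  next
    case False
    have fR: "finite ?R" using fin by blast
    have max: "Max ?R \<in> ?R" by (rule Max_in[OF fR False])
    have "{..Max ?R} \<inter> set_pmf p = ?R"
    proof safe
      fix x assume "x \<in> set_pmf p" "x \<le> Max ?R"
      then show "x < s" using max by auto
    next
      fix x assume "x \<in> set_pmf p" "x < s"
      then show "x \<le> Max ?R" using fR by auto
    qed
    then have "measure (measure_pmf p) {..<s} = cdf p (Max ?R)"
      using measure_Int_set_pmf[of p "{..<s}"] measure_Int_set_pmf[of p "{..Max ?R}"] by simp
    moreover have "quantile p t < s \<longleftrightarrow> quantile p t \<le> Max ?R"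
      using quantile_in[OF fin t] max fR by auto
    ultimately show ?thesis using quantile_le_iff[OF fin t] by simp
  qed
  moreover have "quantile p t = s \<longleftrightarrow> quantile p t \<le> s \<and> \<not> quantile p t < s" for t by auto
  ultimately show ?thesis
    using quantile_le_iff[OF fin, of _ s] sub by blast
qed

lemma prob_quantile:
  assumes fin: "finite (set_pmf p)"
  shows "prob (quantile p -` {s} \<inter> space M) = pmf p s"
proof -
  let ?c = "measure (measure_pmf p) {..<s}"
  have "cdf p s = measure (measure_pmf p) ({..<s} \<union> {s})" by (rule arg_cong[of _ _ "measure _"]) auto
  also have "\<dots> = ?c + pmf p s"
    by (subst measure_pmf.finite_measure_Union) (auto simp: measure_pmf_single)
  finally have c: "cdf p s = ?c + pmf p s" .
  then have "T ?c \<subseteq> T (cdf p s)" by (intro T_mono) simp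
  then have "prob (T (cdf p s) - T ?c) = prob (T (cdf p s)) - prob (T ?c)"
    by (intro finite_measure_Diff T_sets)
  also have "\<dots> = pmf p s"
    using c unfolding prob_T[OF measure_nonneg measure_pmf.prob_le_1] by simp
  finally show ?thesis by (simp add: quantile_eq_set[OF fin])
qed

lemma quantile_random_var:
  assumes "set_pmf p \<in> K"
  shows "quantile p \<in> random_vars M S" "essential_image M (quantile p) = set_pmf p"
proof -
  have fin: "finite (set_pmf p)" using assms by (rule face_finite)
  show "quantile p \<in> random_vars M S"
    using fin face_subset[OF assms] quantile_in[OF fin]
    by (intro random_vars_finite[where F = "set_pmf p"]) (auto simp: quantile_eq_set T_sets)
  show "essential_image M (quantile p) = set_pmf p"
    by (auto simp: essential_image_def prob_quantile[OF fin] set_pmf_iff pmf_nonneg less_le)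
qed

text \<open>The canonical random variable with law \<open>p\<close>: a section of \<open>law\<close>.\<close>
definition realize :: "'s pmf \<Rightarrow> ('w \<Rightarrow> 's) set" where
  "realize p = ae_class M S (quantile p)"

lemma realize_in:
  assumes "set_pmf p \<in> K"
  shows "realize p \<in> Lset" "support (realize p) = set_pmf p"
  using quantile_random_var[OF assms] assms support_ae_class[of "quantile p"]
  by (auto simp: realize_def Lset_iff intro: ae_class_in_Lone)

lemma law_realize:
  assumes "set_pmf p \<in> K"
  shows "law (realize p) = p"
proof (rule pmf_eqI)
  fix s
  note q = quantile_random_var[OF assms]
  have "pmf (law (realize p)) s = prob (rv_rep (realize p) -` {s} \<inter> space M)"
    by (rule pmf_law[OF realize_in(1)[OF assms]])
  also have "\<dots> = prob (quantile p -` {s} \<inter> space M)"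
    using rv_rep_ae_class[OF q(1)] sets_eq_random_var[OF q(1)]
      sets_eq_random_var[OF Lset_rv[OF realize_in(1)[OF assms]]]
    by (intro finite_measure_eq_AE) (auto simp: realize_def elim: eventually_mono)
  also have "\<dots> = pmf p s" using assms by (simp add: prob_quantile face_finite)
  finally show "pmf (law (realize p)) s = pmf p s" .
qed

lemma prob_T_diff:
  assumes "0 \<le> a" "a \<le> 1" "0 \<le> b" "b \<le> 1"
  shows "prob (T a - T b \<union> (T b - T a)) = \<bar>a - b\<bar>"
proof -
  have *: "prob (T a - T b \<union> (T b - T a)) = \<bar>a - b\<bar>" if "a \<le> b" "0 \<le> a" "b \<le> 1" for a b
  proof -
    have "T a \<subseteq> T b" using that by (intro T_mono)
    then have "T a - T b \<union> (T b - T a) = T b - T a" "prob (T b - T a) = prob (T b) - prob (T a)"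
      by (auto intro: finite_measure_Diff T_sets)
    then show ?thesis using that by (simp add: prob_T)
  qed
  show ?thesis using *[of a b] *[of b a] assms by (cases "a \<le> b") (auto simp: Un_commute)
qed

text \<open>
  The quantile functions differ at \<open>t\<close> only if some level sets do, and nested events differ by a set
  whose probability is the difference of their probabilities.
\<close>
lemma realize_dist:
  assumes F: "F \<in> K" and p: "p \<in> closed_simplex F" and q: "q \<in> closed_simplex F"
  shows "Lone_dist M (realize p) (realize q) \<le> (\<Sum>s\<in>F. \<bar>cdf p s - cdf q s\<bar>)"
proof -
  let ?D = "\<lambda>s. T (cdf p s) - T (cdf q s) \<union> (T (cdf q s) - T (cdf p s))"
  have pq: "set_pmf p \<subseteq> F" "set_pmf q \<subseteq> F" using p q by (auto simp: closed_simplex_def)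
  then have K: "set_pmf p \<in> K" "set_pmf q \<in> K" using face_closed[OF F] set_pmf_not_empty by metis+
  note fin = K[THEN face_finite]
  have "t \<in> (\<Union>s\<in>F. ?D s)" if t: "t \<in> space M" "quantile p t \<noteq> quantile q t" for t
  proof (rule ccontr)
    assume "t \<notin> (\<Union>s\<in>F. ?D s)"
    then have "quantile p t \<le> s \<longleftrightarrow> quantile q t \<le> s" if "s \<in> F" for s
      using that quantile_le_iff[OF fin(1) t(1)] quantile_le_iff[OF fin(2) t(1)] by auto
    moreover have "quantile p t \<in> F" "quantile q t \<in> F"
      using pq quantile_in[OF fin(1) t(1)] quantile_in[OF fin(2) t(1)] by auto
    ultimately have "quantile p t = quantile q t" by (meson order.antisym order.refl)
    then show False using t(2) by simp
  qed
  then have "prob {t \<in> space M. quantile p t \<noteq> quantile q t} \<le> prob (\<Union>s\<in>F. ?D s)"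
    using face_finite[OF F] by (intro finite_measure_mono sets.finite_UN sets.Un sets.Diff T_sets) auto
  also have "\<dots> \<le> (\<Sum>s\<in>F. prob (?D s))"
    using face_finite[OF F] by (intro measure_UNION_le sets.Un sets.Diff T_sets) auto
  also have "\<dots> = (\<Sum>s\<in>F. \<bar>cdf p s - cdf q s\<bar>)" by (intro sum.cong prob_T_diff) auto
  finally show ?thesis
    unfolding realize_def by (simp add: Lone_dist_ae_class quantile_random_var K)
qed

text \<open>The random variable equal to \<open>B\<close> on the event \<open>T t\<close> and to \<open>A\<close> elsewhere.\<close>
definition mix :: "real \<Rightarrow> ('w \<Rightarrow> 's) set \<Rightarrow> ('w \<Rightarrow> 's) set \<Rightarrow> ('w \<Rightarrow> 's) set" where
  "mix t A B = ae_class M S (\<lambda>\<omega>. if \<omega> \<in> T t then rv_rep B \<omega> else rv_rep A \<omega>)"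

lemma mix_in:
  assumes A: "A \<in> Lset" and B: "B \<in> Lset" and sub: "support B \<subseteq> support A"
  shows "mix t A B \<in> Lset" "support (mix t A B) \<subseteq> support A"
proof -
  let ?f = "\<lambda>\<omega>. if \<omega> \<in> T t then rv_rep B \<omega> else rv_rep A \<omega>"
  have f: "?f \<in> random_vars M S" by (intro random_vars_If Lset_rv A B T_sets)
  have "AE \<omega> in M. ?f \<omega> \<in> support A"
    using AE_support[OF A] AE_support[OF B] by eventually_elim (use sub in auto)
  from essential_image_subset[OF f this]
  show sup: "support (mix t A B) \<subseteq> support A" by (simp add: mix_def support_ae_class[OF f])
  have "essential_image M ?f \<noteq> {}"
  proof
    assume "essential_image M ?f = {}"
    then have "AE \<omega> in M. False" using AE_essential_image[OF f] by simp
    then show False by simp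
  qed
  then have "support (mix t A B) \<in> K"
    using sup A face_closed by (auto simp: mix_def support_ae_class[OF f] Lset_iff)
  then show "mix t A B \<in> Lset" by (simp add: Lset_iff mix_def ae_class_in_Lone[OF f])
qed

lemma mix_ends:
  assumes "A \<in> Lset" "B \<in> Lset"
  shows "mix 0 A B = A" "mix 1 A B = B"
proof -
  show "mix 0 A B = A"
    using rv_rep_in(2)[OF Lset_Lone[OF assms(1)]] by (simp add: mix_def T_0)
  show "mix 1 A B = B"
    unfolding mix_def using assms AE_space
    by (intro ae_class_eqI random_vars_If Lset_rv T_sets Lset_Lone) (auto simp: T_1 elim: eventually_mono)
qed

lemma mix_dist:
  assumes Lset: "A \<in> Lset" "B \<in> Lset" "A' \<in> Lset" "B' \<in> Lset"
    and st: "0 \<le> s" "s \<le> 1" "0 \<le> t" "t \<le> 1"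
  shows "Lone_dist M (mix s A B) (mix t A' B') \<le> \<bar>s - t\<bar> + Lone_dist M A A' + Lone_dist M B B'"
proof -
  let ?f = "\<lambda>\<omega>. if \<omega> \<in> T s then rv_rep B \<omega> else rv_rep A \<omega>"
  let ?g = "\<lambda>\<omega>. if \<omega> \<in> T t then rv_rep B' \<omega> else rv_rep A' \<omega>"
  let ?D = "T s - T t \<union> (T t - T s)"
  let ?E = "{\<omega> \<in> space M. rv_rep A \<omega> \<noteq> rv_rep A' \<omega>}"
  let ?F = "{\<omega> \<in> space M. rv_rep B \<omega> \<noteq> rv_rep B' \<omega>}"
  have rv: "?f \<in> random_vars M S" "?g \<in> random_vars M S"
    by (intro random_vars_If Lset_rv Lset T_sets)+
  have sets: "?D \<in> sets M" "?E \<in> sets M" "?F \<in> sets M"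
    using T_sets sets_neq[OF Lset(1,3)[THEN Lset_rv]] sets_neq[OF Lset(2,4)[THEN Lset_rv]] by blast+
  have "prob {\<omega> \<in> space M. ?f \<omega> \<noteq> ?g \<omega>} \<le> prob (?D \<union> ?E \<union> ?F)"
    using sets by (intro finite_measure_mono) auto
  moreover have "prob (?D \<union> ?E \<union> ?F) \<le> prob (?D \<union> ?E) + prob ?F"
    using sets by (intro measure_Un_le) auto
  moreover have "prob (?D \<union> ?E) \<le> prob ?D + prob ?E" using sets by (intro measure_Un_le)
  ultimately have "prob {\<omega> \<in> space M. ?f \<omega> \<noteq> ?g \<omega>} \<le> prob ?D + prob ?E + prob ?F" by linarith
  then show ?thesis
    unfolding mix_def Lone_dist_ae_class[OF rv] prob_T_diff[OF st] by (simp add: Lone_dist_eq_measure)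
qed


section \<open>The metric topology, the weak topology and the geometric realization\<close>

lemma geometric_realization_eq: "geometric_realization K = weak_topology K simplex_topology"
proof -
  have "set_pmf p \<in> K" if "F \<in> K" "set_pmf p \<subseteq> F" for p F
    using face_closed[OF that set_pmf_not_empty] .
  then have "{p. set_pmf p \<in> K} = (\<Union>F\<in>K. closed_simplex F)"
    by (auto simp: closed_simplex_def)
  then show ?thesis
    by (simp add: topology_eq openin_geometric_realization openin_weak_topology)
qed

lemma topspace_realization [simp]: "topspace (geometric_realization K) = {p. set_pmf p \<in> K}"
  using complex by (rule topspace_geometric_realization)

text \<open>The random variables with essential image in \<open>F\<close>, with the metric topology.\<close>
definition piece :: "'s set \<Rightarrow> ('w \<Rightarrow> 's) set topology" where
  "piece F = subtopology (complex_L M S K) {A. support A \<subseteq> F}"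

text \<open>
  The set \<open>L(K)\<close> with the weak topology determined by the simplices of \<open>K\<close>. It has in general more
  open sets than the metric topology, as the weak topology of a geometric realization has.
\<close>
definition weak_L :: "('w \<Rightarrow> 's) set topology" where
  "weak_L = weak_topology K piece"

lemma topspace_piece [simp]: "topspace (piece F) = {A \<in> Lset. support A \<subseteq> F}"
  by (auto simp: piece_def)

lemma topspace_weak_L [simp]: "topspace weak_L = Lset"
  by (auto simp: weak_L_def topspace_weak_topology Lset_iff)

lemma continuous_map_weak_L: "continuous_map weak_L (complex_L M S K) id"
  unfolding weak_L_def piece_def
  by (intro continuous_map_from_weak_topology continuous_map_from_subtopology) simp

lemma continuous_map_realize_piece:
  assumes F: "F \<in> K"
  shows "continuous_map (simplex_topology F) (piece F) realize"
  unfolding piece_def continuous_map_in_subtopology complex_L_eq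
proof
  have K: "set_pmf p \<in> K" "set_pmf p \<subseteq> F" if "p \<in> closed_simplex F" for p
    using that face_closed[OF F _ set_pmf_not_empty] by (auto simp: closed_simplex_def)
  show "realize \<in> topspace (simplex_topology F) \<rightarrow> {A. support A \<subseteq> F}"
    using K realize_in(2) by auto
  have cdf: "continuous_map (simplex_topology F) euclideanreal (\<lambda>p. cdf p s)" for s
  proof (rule continuous_map_eq)
    show "continuous_map (simplex_topology F) euclideanreal (\<lambda>p. \<Sum>r\<in>{..s} \<inter> F. pmf p r)"
      using face_finite[OF F] by (intro continuous_map_sum continuous_map_pmf) auto
    fix p assume "p \<in> topspace (simplex_topology F)"
    then have "({..s} \<inter> F) \<inter> set_pmf p = {..s} \<inter> set_pmf p" by (auto simp: closed_simplex_def)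
    then have "cdf p s = measure (measure_pmf p) ({..s} \<inter> F)"
      using measure_Int_set_pmf[of p "{..s} \<inter> F"] measure_Int_set_pmf[of p "{..s}"] by simp
    then show "(\<Sum>r\<in>{..s} \<inter> F. pmf p r) = cdf p s"
      using face_finite[OF F] by (simp add: measure_measure_pmf_finite)
  qed
  show "continuous_map (simplex_topology F) L.mtopology realize"
  proof (rule L.continuous_map_to_metric_bound)
    show "realize \<in> topspace (simplex_topology F) \<rightarrow> Lset" using K realize_in(1) by auto
    fix p assume p: "p \<in> topspace (simplex_topology F)"
    have "continuous_map (simplex_topology F) euclideanreal (\<lambda>q. \<Sum>s\<in>F. \<bar>cdf p s - cdf q s\<bar>)"
      using face_finite[OF F]
      by (intro continuous_map_sum continuous_map_real_abs continuous_map_diff cdf) auto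
    then show "\<exists>b. continuous_map (simplex_topology F) euclideanreal b \<and> b p = 0 \<and>
        (\<forall>q\<in>topspace (simplex_topology F). Lone_dist M (realize p) (realize q) \<le> b q)"
      using p realize_dist[OF F]
      by (intro exI[of _ "\<lambda>q. \<Sum>s\<in>F. \<bar>cdf p s - cdf q s\<bar>"] conjI) auto
  qed
qed

lemma continuous_map_realize_weak_L: "continuous_map (geometric_realization K) weak_L realize"
  unfolding geometric_realization_eq weak_L_def
  by (intro continuous_map_from_weak_topology continuous_map_into_weak_topology)
    (auto intro: continuous_map_realize_piece)

lemma continuous_map_realize: "continuous_map (geometric_realization K) (complex_L M S K) realize"
  using continuous_map_compose[OF continuous_map_realize_weak_L continuous_map_weak_L] by simp

text \<open>The law with its points of small probability removed.\<close>
definition approx_law :: "('w \<Rightarrow> 's) set \<Rightarrow> 's pmf" where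
  "approx_law A = shrink 1 (law A)"

lemma set_pmf_approx_law:
  assumes "A \<in> Lset"
  shows "set_pmf (approx_law A) \<subseteq> support A" "set_pmf (approx_law A) \<in> K"
proof -
  have "finite (set_pmf (law A))" using assms by (simp add: set_pmf_law Lset_iff face_finite)
  from set_pmf_shrink_subset[OF this, of 1]
  show sub: "set_pmf (approx_law A) \<subseteq> support A" using assms by (simp add: approx_law_def set_pmf_law)
  show "set_pmf (approx_law A) \<in> K"
    using face_closed[OF _ sub set_pmf_not_empty] assms by (simp add: Lset_iff)
qed

text \<open>
  Near \<open>A\<close>, a point outside the essential image of \<open>A\<close> has a probability too small to survive, so
  the truncated laws stay in one closed simplex. The untruncated law has no such property, and
  is in general not continuous for the weak topology.
\<close>
lemma continuous_map_approx_law: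
  "continuous_map (complex_L M S K) (geometric_realization K) approx_law"
  unfolding complex_L_eq
proof (rule pasting_lemma[where I = Lset and T = "\<lambda>A. L.mball A (pmf_height (law A) / 3)"
      and f = "\<lambda>_. approx_law"])
  fix A assume A: "A \<in> Lset"
  let ?m = "pmf_height (law A)"
  \<comment> \<open>Within distance \<open>?m / 3\<close>, a surviving point has probability above \<open>(?m - ?m / 3) / 2 = ?m / 3\<close>,
    hence positive probability for \<open>A\<close>.\<close>
  let ?X = "subtopology L.mtopology (L.mball A (?m / 3))"
  have law_cont: "continuous_map L.mtopology euclideanreal (\<lambda>B. pmf (law B) s)" for s
    by (rule L.continuous_map_real_nonexpansive) (rule law_Lipschitz)
  have height_cont: "continuous_map L.mtopology euclideanreal (\<lambda>B. pmf_height (law B))"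
    by (rule L.continuous_map_real_nonexpansive) (rule pmf_height_Lipschitz, rule law_Lipschitz)
  have "continuous_map ?X (simplex_topology (support A)) (\<lambda>B. shrink 1 (law B))"
  proof (rule continuous_map_shrink)
    fix B assume "B \<in> topspace ?X"
    then have B: "B \<in> Lset" "Lone_dist M A B < ?m / 3" by auto
    show fin: "finite (set_pmf (law B))" using B(1) by (simp add: set_pmf_law Lset_iff face_finite)
    show "set_pmf (shrink 1 (law B)) \<subseteq> support A"
    proof
      fix s assume "s \<in> set_pmf (shrink 1 (law B))"
      then have "pmf_height (law B) / 2 < pmf (law B) s" by (simp add: set_pmf_shrink[OF fin])
      moreover have "\<bar>pmf_height (law A) - pmf_height (law B)\<bar> < ?m / 3"
        using pmf_height_Lipschitz[OF law_Lipschitz[OF A B(1)]] B(2) by linarith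
      moreover have "\<bar>pmf (law A) s - pmf (law B) s\<bar> < ?m / 3"
        using law_Lipschitz[OF A B(1), of s] B(2) by linarith
      ultimately have "0 < pmf (law A) s" by linarith
      then have "s \<in> set_pmf (law A)" by (simp add: set_pmf_iff)
      then show "s \<in> support A" by (simp only: set_pmf_law[OF A])
    qed
  next
    show "finite (support A)" using A by (simp add: Lset_iff face_finite)
    show "continuous_map ?X euclideanreal (\<lambda>B. pmf (law B) s)" for s
      by (rule continuous_map_from_subtopology[OF law_cont])
    show "continuous_map ?X euclideanreal (\<lambda>B. pmf_height (law B))"
      by (rule continuous_map_from_subtopology[OF height_cont])
  qed simp_all
  then have "continuous_map ?X (simplex_topology (support A)) approx_law"
    by (simp only: approx_law_def[abs_def])
  moreover have "support A \<in> K" using A by (simp add: Lset_iff)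
  ultimately show "continuous_map ?X (geometric_realization K) approx_law"
    unfolding geometric_realization_eq by (rule continuous_map_into_weak_topology[rotated])
next
  fix A assume "A \<in> topspace L.mtopology"
  then have "A \<in> Lset" "A \<in> L.mball A (pmf_height (law A) / 3)" by (simp_all add: pmf_height_pos)
  then show "\<exists>B. B \<in> Lset \<and> A \<in> L.mball B (pmf_height (law B) / 3) \<and> approx_law A = approx_law A"
    by blast
qed simp_all

lemma approx_law_realize: "set_pmf p \<in> K \<Longrightarrow> approx_law (realize p) = shrink 1 p"
  by (simp add: approx_law_def law_realize)

lemma shrink_homotopic_id:
  "homotopic_with (\<lambda>_. True) (geometric_realization K) (geometric_realization K) (shrink 1) id"
proof (subst homotopic_with_sym, rule homotopic_withI)
  let ?I = "top_of_set {0..1::real}"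
  show "continuous_map (prod_topology ?I (geometric_realization K)) (geometric_realization K)
      (\<lambda>(t, p). shrink t p)"
    unfolding geometric_realization_eq
  proof (intro continuous_map_interval_prod_weak_topology)
    fix F assume F: "F \<in> K"
    let ?X = "prod_topology ?I (simplex_topology F)"
    have fin: "finite (set_pmf p)" if "p \<in> closed_simplex F" for p
      using that face_finite[OF F] finite_subset by (auto simp: closed_simplex_def)
    have "continuous_map ?X (simplex_topology F) (\<lambda>x. shrink (fst x) (snd x))"
    proof (rule continuous_map_shrink)
      show "set_pmf (shrink (fst x) (snd x)) \<subseteq> F" if "x \<in> topspace ?X" for x
        using that set_pmf_shrink_subset[OF fin, of "snd x" "fst x"] by (fastforce simp: closed_simplex_def)
      show "continuous_map ?X euclideanreal fst"
        using continuous_map_fst[of ?I] continuous_map_into_fulltopology by blast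
      show "continuous_map ?X euclideanreal (\<lambda>x. pmf (snd x) s)" for s
        using continuous_map_compose[OF continuous_map_snd continuous_map_pmf] by (simp add: comp_def)
      show "continuous_map ?X euclideanreal (\<lambda>x. pmf_height (snd x))"
        using continuous_map_compose[OF continuous_map_snd continuous_map_pmf_height[OF face_finite[OF F]]]
        by (simp add: comp_def)
    qed (use fin face_finite[OF F] in auto)
    then show "continuous_map ?X (weak_topology K simplex_topology) (\<lambda>(t, p). shrink t p)"
      using F by (intro continuous_map_into_weak_topology[where i = F]) (auto simp: case_prod_unfold)
  qed
qed (auto simp: shrink_0 face_finite)

text \<open>
  The homotopy from the identity to \<open>realize \<circ> approx_law\<close>: at time \<open>t\<close> the random variable has been
  replaced on the event \<open>T t\<close>. It never enlarges the essential image.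
\<close>
definition replacement :: "real \<times> ('w \<Rightarrow> 's) set \<Rightarrow> ('w \<Rightarrow> 's) set" where
  "replacement = (\<lambda>(t, A). mix t A (realize (approx_law A)))"

lemma realize_approx_law:
  assumes "A \<in> Lset"
  shows "realize (approx_law A) \<in> Lset" "support (realize (approx_law A)) \<subseteq> support A"
  using realize_in[OF set_pmf_approx_law(2)[OF assms]] set_pmf_approx_law(1)[OF assms] by auto

lemma replacement_in:
  assumes "A \<in> Lset"
  shows "replacement (t, A) \<in> Lset" "support (replacement (t, A)) \<subseteq> support A"
  using mix_in[OF assms realize_approx_law[OF assms]] by (auto simp: replacement_def)

lemma replacement_ends:
  "A \<in> Lset \<Longrightarrow> replacement (0, A) = A" "A \<in> Lset \<Longrightarrow> replacement (1, A) = realize (approx_law A)"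
  by (simp_all add: replacement_def mix_ends realize_approx_law)

lemma continuous_map_replacement:
  "continuous_map (prod_topology (top_of_set {0..1}) (complex_L M S K)) (complex_L M S K) replacement"
  unfolding complex_L_eq
proof (rule L.continuous_map_to_metric_bound)
  let ?X = "prod_topology (top_of_set {0..1::real}) L.mtopology"
  let ?g = "realize \<circ> approx_law"
  show "replacement \<in> topspace ?X \<rightarrow> Lset" using replacement_in(1) by auto
  fix x assume "x \<in> topspace ?X"
  then obtain s A where x: "x = (s, A)" "0 \<le> s" "s \<le> 1" "A \<in> Lset" by (cases x) auto
  have g: "continuous_map L.mtopology L.mtopology ?g"
    using continuous_map_compose[OF continuous_map_approx_law continuous_map_realize]
    by (simp add: complex_L_eq)
  have fst: "continuous_map ?X euclideanreal fst"
    using continuous_map_fst[of "top_of_set {0..1}"] continuous_map_into_fulltopology by blast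
  have 1: "continuous_map ?X euclideanreal (Lone_dist M A \<circ> snd)"
    using x(4) by (intro continuous_map_compose[OF continuous_map_snd] L.continuous_map_dist_from)
  have 2: "continuous_map ?X euclideanreal (Lone_dist M (?g A) \<circ> (?g \<circ> snd))"
    using x(4) by (intro continuous_map_compose[OF continuous_map_compose[OF continuous_map_snd g]]
        L.continuous_map_dist_from) (simp add: realize_approx_law)
  let ?b = "\<lambda>y. \<bar>s - fst y\<bar> + (Lone_dist M A \<circ> snd) y + (Lone_dist M (?g A) \<circ> (?g \<circ> snd)) y"
  have "continuous_map ?X euclideanreal ?b"
    by (intro continuous_map_add continuous_map_real_abs continuous_map_diff fst 1 2) simp
  moreover have "?b x = 0" using x(1,4) realize_approx_law(1)[OF x(4)] by simp
  moreover have "Lone_dist M (replacement x) (replacement y) \<le> ?b y" if "y \<in> topspace ?X" for y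
  proof -
    obtain t B where "y = (t, B)" by fastforce
    with that have y: "y = (t, B)" "0 \<le> t" "t \<le> 1" "B \<in> Lset" by auto
    show ?thesis
      using mix_dist[OF x(4) realize_approx_law(1)[OF x(4)] y(4) realize_approx_law(1)[OF y(4)] x(2,3) y(2,3)]
      by (simp add: replacement_def x(1) y(1))
  qed
  ultimately show "\<exists>b. continuous_map ?X euclideanreal b \<and> b x = 0 \<and>
      (\<forall>y\<in>topspace ?X. Lone_dist M (replacement x) (replacement y) \<le> b y)"
    by blast
qed

text \<open>
  The homotopy preserves each piece, where the weak and the metric topologies agree.
\<close>
lemma continuous_map_replacement_weak_L:
  "continuous_map (prod_topology (top_of_set {0..1}) weak_L) weak_L replacement"
  unfolding weak_L_def
proof (rule continuous_map_interval_prod_weak_topology, rule continuous_map_into_weak_topology)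
  fix F assume F: "F \<in> K"
  then show "F \<in> K" .
  have eq: "prod_topology (top_of_set {0..1::real}) (piece F) =
      subtopology (prod_topology (top_of_set {0..1}) (complex_L M S K)) (UNIV \<times> {A. support A \<subseteq> F})"
    by (simp add: piece_def subtopology_Times)
  have "replacement \<in> topspace (prod_topology (top_of_set {0..1::real}) (piece F)) \<rightarrow> {A. support A \<subseteq> F}"
    using replacement_in(2) by fastforce
  moreover have "continuous_map (prod_topology (top_of_set {0..1}) (piece F)) (complex_L M S K) replacement"
    unfolding eq by (rule continuous_map_from_subtopology[OF continuous_map_replacement])
  ultimately have "continuous_map (prod_topology (top_of_set {0..1}) (piece F))
      (subtopology (complex_L M S K) {A. support A \<subseteq> F}) replacement"
    by (simp only: continuous_map_in_subtopology)
  then show "continuous_map (prod_topology (top_of_set {0..1}) (piece F)) (piece F) replacement"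
    by (simp only: piece_def[symmetric])
qed

text \<open>
  The same maps and homotopies serve for both topologies on \<open>L(K)\<close>.
\<close>
lemma homotopy_equivalent_realization:
  assumes X: "topspace X = Lset" and approx: "continuous_map X (geometric_realization K) approx_law"
    and realize: "continuous_map (geometric_realization K) X realize"
    and replacement: "continuous_map (prod_topology (top_of_set {0..1}) X) X replacement"
  shows "X homotopy_equivalent_space geometric_realization K"
  unfolding homotopy_equivalent_space_def
proof (intro exI conjI)
  show "homotopic_with (\<lambda>_. True) X X (realize \<circ> approx_law) id"
    by (subst homotopic_with_sym, rule homotopic_withI[OF replacement]) (simp_all add: X replacement_ends)
  show "homotopic_with (\<lambda>_. True) (geometric_realization K) (geometric_realization K)
      (approx_law \<circ> realize) id"
    by (rule homotopic_with_eq[OF shrink_homotopic_id]) (simp_all add: approx_law_realize)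
qed (fact approx realize)+

lemma complex_L_homotopy_equivalent: "complex_L M S K homotopy_equivalent_space geometric_realization K"
  by (intro homotopy_equivalent_realization continuous_map_approx_law continuous_map_realize
      continuous_map_replacement) simp

lemma weak_L_homotopy_equivalent: "weak_L homotopy_equivalent_space geometric_realization K"
  using continuous_map_compose[OF continuous_map_weak_L continuous_map_approx_law]
  by (intro homotopy_equivalent_realization continuous_map_realize_weak_L
      continuous_map_replacement_weak_L) simp_all

end


section \<open>The realizations of the simplicial and the pre-simplicial set\<close>

lemma openin_cell_sum:
  "openin (cell_sum M F) W \<longleftrightarrow> W \<subseteq> topspace (cell_sum M F) \<and>
    (\<forall>n. \<forall>\<alpha>\<in>cells F n. openin (nabla M n) {a. (n, \<alpha>, a) \<in> W})"
proof -
  have "{x. (n, x) \<in> W} \<subseteq> cells F n \<times> topspace (nabla M n)"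
    if "W \<subseteq> topspace (cell_sum M F)" for n
    using that by (auto simp: cell_sum_def)
  then show ?thesis
    by (auto simp: cell_sum_def openin_sum_topology openin_prod_discrete_topology)
qed

text \<open>
  A position at which \<open>s\<close> occurs in \<open>xs\<close>. The value \<open>0\<close> for other \<open>s\<close> is a position in every
  non-empty list, so that \<open>position xs\<close> turns any random variable into one with values in \<open>{..n}\<close>.
\<close>
definition position :: "'a list \<Rightarrow> 'a \<Rightarrow> nat" where
  "position xs s = (if s \<in> set xs then inv_into {..<length xs} (nth xs) s else 0)"

lemma position:
  assumes "s \<in> set xs"
  shows nth_position: "xs ! position xs s = s" and position_less: "position xs s < length xs"
proof -
  have "s \<in> nth xs ` {..<length xs}" using assms by (auto simp: in_set_conv_nth)
  then show "xs ! position xs s = s" "position xs s < length xs"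
    using assms f_inv_into_f[of s "nth xs"] inv_into_into[of s "nth xs" "{..<length xs}"]
    by (auto simp: position_def)
qed

text \<open>
  The map of indices that expresses \<open>xs\<close> as a tuple of entries of \<open>ys\<close>, extensional like the
  morphisms between the \<open>[n]\<close>.
\<close>
definition reindex :: "'a list \<Rightarrow> 'a list \<Rightarrow> nat \<Rightarrow> nat" where
  "reindex xs ys = (\<lambda>i\<in>{..length xs - 1}. position ys (xs ! i))"

context random_simplices
begin
interpretation L: Metric_space Lset "Lone_dist M"
  by (rule Metric_space_Lset)

lemma Metric_space_nabla: "Metric_space (Lone M {..n}) (Lone_dist M)" for n :: nat
  by (rule Metric_space_Lone) unfold_locales

lemma topspace_nabla [simp]: "topspace (nabla M n) = Lone M {..n}"
  by (simp add: nabla_def Metric_space.topspace_mtopology[OF Metric_space_nabla])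

lemma SK_cells: "xs \<in> cells (SK K) n \<longleftrightarrow> length xs = Suc n \<and> sorted xs \<and> set xs \<in> K"
  by (simp add: SK_def)

lemma SK_act: "act (SK K) n m \<sigma> \<alpha> = map (\<lambda>i. \<alpha> ! \<sigma> i) [0..<Suc n]"
  by (simp add: SK_def)

lemma nabla_le: "a \<in> Lone M {..n} \<Longrightarrow> t \<in> space M \<Longrightarrow> rv_rep a t \<le> n" for n :: nat
  using rv_rep_in(1)[of a M "{..n}"] measurable_space[of "rv_rep a" M "count_space {..n}" t]
  by (auto simp: random_vars_def)

text \<open>
  The random variable described by a cell and a random index. This map identifies both
  realizations with \<open>weak_L\<close>.
\<close>
definition evaluate :: "nat \<times> 's list \<times> ('w \<Rightarrow> nat) set \<Rightarrow> ('w \<Rightarrow> 's) set" where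
  "evaluate = (\<lambda>(n, xs, a). ae_class M S (nth xs \<circ> rv_rep a))"

lemma evaluate_rv:
  assumes xs: "xs \<in> cells (SK K) n" and a: "a \<in> Lone M {..n}"
  shows "nth xs \<circ> rv_rep a \<in> random_vars M S"
proof (rule random_vars_compose[OF rv_rep_in(1)[OF a]])
  show "nth xs \<in> {..n} \<rightarrow> S" using xs face_subset[of "set xs"] by (auto simp: SK_cells)
qed

lemma evaluate_in:
  assumes xs: "xs \<in> cells (SK K) n" and a: "a \<in> Lone M {..n}"
  shows "evaluate (n, xs, a) \<in> Lset" "support (evaluate (n, xs, a)) \<subseteq> set xs"
proof -
  note rv = evaluate_rv[OF assms]
  have "nth xs \<circ> rv_rep a \<in> space M \<rightarrow> set xs"
    using xs nabla_le[OF a] by (auto simp: SK_cells less_Suc_eq_le)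
  from essential_image_subset_range[OF this]
  show sub: "support (evaluate (n, xs, a)) \<subseteq> set xs"
    by (simp add: evaluate_def support_ae_class[OF rv])
  have "essential_image M (nth xs \<circ> rv_rep a) \<noteq> {}"
  proof
    assume "essential_image M (nth xs \<circ> rv_rep a) = {}"
    then have "AE \<omega> in M. False" using AE_essential_image[OF rv] by simp
    then show False by simp
  qed
  then have "support (evaluate (n, xs, a)) \<noteq> {}" by (simp add: evaluate_def support_ae_class[OF rv])
  then have "support (evaluate (n, xs, a)) \<in> K"
    using xs face_closed[OF _ sub] by (simp add: SK_cells)
  then show "evaluate (n, xs, a) \<in> Lset"
    by (simp add: Lset_iff evaluate_def ae_class_in_Lone[OF rv])
qed

lemma evaluate_AE:
  assumes "xs \<in> cells (SK K) n" "a \<in> Lone M {..n}"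
  shows "AE t in M. rv_rep (evaluate (n, xs, a)) t = xs ! rv_rep a t"
  using rv_rep_ae_class[OF evaluate_rv[OF assms]] by (simp add: evaluate_def)

lemma evaluate_dist:
  assumes xs: "xs \<in> cells (SK K) n" and a: "a \<in> Lone M {..n}" and b: "b \<in> Lone M {..n}"
  shows "Lone_dist M (evaluate (n, xs, a)) (evaluate (n, xs, b)) \<le> Lone_dist M a b"
  unfolding evaluate_def prod.case Lone_dist_ae_class[OF evaluate_rv[OF xs a] evaluate_rv[OF xs b]]
    Lone_dist_eq_measure[of M a b]
  by (intro finite_measure_mono sets_neq[OF rv_rep_in(1)[OF a] rv_rep_in(1)[OF b]]) auto

lemma evaluate_inj:
  assumes xs: "xs \<in> cells (SK K) n" "distinct xs" and a: "a \<in> Lone M {..n}" and b: "b \<in> Lone M {..n}"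
    and eq: "evaluate (n, xs, a) = evaluate (n, xs, b)"
  shows "a = b"
proof (rule Lone_eqI[OF a b])
  show "AE t in M. rv_rep a t = rv_rep b t"
    using evaluate_AE[OF xs(1) a, unfolded eq] evaluate_AE[OF xs(1) b] AE_space
  proof eventually_elim
    fix t assume "rv_rep (evaluate (n, xs, b)) t = xs ! rv_rep a t"
      "rv_rep (evaluate (n, xs, b)) t = xs ! rv_rep b t" "t \<in> space M"
    then have "xs ! rv_rep a t = xs ! rv_rep b t" "rv_rep a t < length xs" "rv_rep b t < length xs"
      using nabla_le[OF a] nabla_le[OF b] xs(1) by (auto simp: SK_cells less_Suc_eq_le)
    then show "rv_rep a t = rv_rep b t" using xs(2) by (simp add: nth_eq_iff_index_eq)
  qed
qed

text \<open>The inverse of \<open>evaluate\<close> on a cell without repetitions.\<close>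
definition coordinates :: "nat \<Rightarrow> 's list \<Rightarrow> ('w \<Rightarrow> 's) set \<Rightarrow> ('w \<Rightarrow> nat) set" where
  "coordinates n xs A = ae_class M {..n} (position xs \<circ> rv_rep A)"

lemma coordinates_rv:
  assumes xs: "xs \<in> cells (SK K) n" and A: "A \<in> Lset"
  shows "position xs \<circ> rv_rep A \<in> random_vars M {..n}"
proof (rule random_vars_compose[OF Lset_rv[OF A]])
  have "position xs s \<le> n" for s
    using position_less[of s xs] xs by (cases "s \<in> set xs") (auto simp: SK_cells position_def)
  then show "position xs \<in> S \<rightarrow> {..n}" by simp
qed

lemma coordinates_in: "xs \<in> cells (SK K) n \<Longrightarrow> A \<in> Lset \<Longrightarrow> coordinates n xs A \<in> Lone M {..n}"
  by (simp add: coordinates_def coordinates_rv ae_class_in_Lone)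

lemma evaluate_coordinates:
  assumes xs: "xs \<in> cells (SK K) n" and A: "A \<in> Lset" and sub: "support A \<subseteq> set xs"
  shows "evaluate (n, xs, coordinates n xs A) = A"
proof (rule Lone_eqI[OF Lset_Lone Lset_Lone])
  show "AE t in M. rv_rep (evaluate (n, xs, coordinates n xs A)) t = rv_rep A t"
    using evaluate_AE[OF xs coordinates_in[OF xs A]] AE_support[OF A]
      rv_rep_ae_class[OF coordinates_rv[OF xs A], folded coordinates_def]
    by eventually_elim (use sub in \<open>auto simp: nth_position\<close>)
qed (use A evaluate_in(1)[OF xs coordinates_in[OF xs A]] in auto)

lemma coordinates_dist:
  assumes xs: "xs \<in> cells (SK K) n" and A: "A \<in> Lset" and B: "B \<in> Lset"
  shows "Lone_dist M (coordinates n xs A) (coordinates n xs B) \<le> Lone_dist M A B"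
  unfolding coordinates_def Lone_dist_ae_class[OF coordinates_rv[OF xs A] coordinates_rv[OF xs B]]
    Lone_dist_eq_measure[of M A B]
  by (intro finite_measure_mono sets_neq[OF Lset_rv[OF A] Lset_rv[OF B]]) auto

lemma face_cell:
  assumes "F \<in> K"
  shows "sorted_list_of_set F \<in> cells (SK K) (card F - 1)" "distinct (sorted_list_of_set F)"
    "set (sorted_list_of_set F) = F"
  using face_finite[OF assms] face_nonempty[OF assms] assms by (auto simp: SK_cells card_gt_0_iff)

lemma reindex:
  assumes xs: "xs \<in> cells (SK K) n" and ys: "ys \<in> cells (SK K) m" "distinct ys"
    and sub: "set xs \<subseteq> set ys"
  shows reindex_Delta: "reindex xs ys \<in> Delta_hom n m"
    and reindex_Inj: "distinct xs \<Longrightarrow> reindex xs ys \<in> Inj_hom n m"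
    and act_reindex: "act (SK K) n m (reindex xs ys) ys = xs"
proof -
  have len: "length xs = Suc n" "length ys = Suc m" "sorted xs" "sorted ys"
    using xs ys by (auto simp: SK_cells)
  have eq: "reindex xs ys i = position ys (xs ! i)" "ys ! reindex xs ys i = xs ! i" "reindex xs ys i \<le> m"
    if "i \<le> n" for i
  proof -
    have "xs ! i \<in> set ys" using that len sub by (auto simp: less_Suc_eq_le)
    then show "reindex xs ys i = position ys (xs ! i)" "ys ! reindex xs ys i = xs ! i" "reindex xs ys i \<le> m"
      using that len nth_position[of "xs ! i" ys] position_less[of "xs ! i" ys]
      by (auto simp: reindex_def less_Suc_eq_le)
  qed
  show D: "reindex xs ys \<in> Delta_hom n m"
    unfolding Delta_hom_def
  proof (intro CollectI conjI mono_onI PiE_I)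
    fix i j assume ij: "i \<in> {..n}" "j \<in> {..n}" "i \<le> j"
    show "reindex xs ys i \<le> reindex xs ys j"
    proof (rule ccontr)
      assume "\<not> reindex xs ys i \<le> reindex xs ys j"
      moreover have "sorted_wrt (<) ys" using len(4) ys(2) by (simp add: strict_sorted_iff)
      ultimately have "ys ! reindex xs ys j < ys ! reindex xs ys i"
        using eq(3)[of i] ij len(2) sorted_wrt_nth_less[of "(<)" ys "reindex xs ys j" "reindex xs ys i"]
        by simp
      moreover have "xs ! i \<le> xs ! j" using len(1,3) ij by (intro sorted_nth_mono) auto
      ultimately show False using eq(2)[of i] eq(2)[of j] ij by simp
    qed
  qed (use eq(3) len in \<open>auto simp: reindex_def\<close>)
  show "reindex xs ys \<in> Inj_hom n m" if dist: "distinct xs"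
  proof -
    have "inj_on (reindex xs ys) {..n}"
    proof (rule inj_onI)
      fix i j assume ij: "i \<in> {..n}" "j \<in> {..n}" "reindex xs ys i = reindex xs ys j"
      then have "xs ! i = xs ! j" using eq(2)[of i] eq(2)[of j] by simp
      then show "i = j" using ij len(1) dist by (simp add: nth_eq_iff_index_eq)
    qed
    then show ?thesis using D by (simp add: Inj_hom_def)
  qed
  show "act (SK K) n m (reindex xs ys) ys = xs"
    using len eq(2) unfolding SK_act by (intro nth_equalityI) (auto simp del: upt_Suc simp: less_Suc_eq_le)
qed

lemma glue_evaluate:
  assumes \<sigma>: "\<sigma> \<in> Delta_hom n m" and \<alpha>: "\<alpha> \<in> cells (SK K) m" and a: "a \<in> Lone M {..n}"
  shows "Lone_map M {..m} \<sigma> a \<in> Lone M {..m}"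
    and "evaluate (n, act (SK K) n m \<sigma> \<alpha>, a) = evaluate (m, \<alpha>, Lone_map M {..m} \<sigma> a)"
proof -
  have "\<sigma> \<in> {..n} \<rightarrow> {..m}" using \<sigma> by (auto simp: Delta_hom_def)
  then have rv: "\<sigma> \<circ> rv_rep a \<in> random_vars M {..m}"
    by (rule random_vars_compose[OF rv_rep_in(1)[OF a]])
  then show \<sigma>a: "Lone_map M {..m} \<sigma> a \<in> Lone M {..m}" by (simp add: Lone_map_def ae_class_in_Lone)
  have "act (SK K) n m \<sigma> \<alpha> \<in> cells (SK K) n"
    using simplicial_set_SK[OF complex, unfolded presheaf_on_def, THEN conjunct1, rule_format, OF \<sigma>] \<alpha>
    by (rule funcset_mem)
  note cells = this \<alpha>
  show "evaluate (n, act (SK K) n m \<sigma> \<alpha>, a) = evaluate (m, \<alpha>, Lone_map M {..m} \<sigma> a)"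
  proof (rule Lone_eqI[OF Lset_Lone Lset_Lone])
    show "AE t in M. rv_rep (evaluate (n, act (SK K) n m \<sigma> \<alpha>, a)) t =
        rv_rep (evaluate (m, \<alpha>, Lone_map M {..m} \<sigma> a)) t"
      using evaluate_AE[OF cells(1) a] evaluate_AE[OF cells(2) \<sigma>a] AE_space
        rv_rep_ae_class[OF rv, folded Lone_map_def]
    proof eventually_elim
      fix t assume t: "rv_rep (evaluate (n, act (SK K) n m \<sigma> \<alpha>, a)) t = act (SK K) n m \<sigma> \<alpha> ! rv_rep a t"
        "rv_rep (evaluate (m, \<alpha>, Lone_map M {..m} \<sigma> a)) t = \<alpha> ! rv_rep (Lone_map M {..m} \<sigma> a) t"
        "t \<in> space M" "rv_rep (Lone_map M {..m} \<sigma> a) t = (\<sigma> \<circ> rv_rep a) t"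
      then have "rv_rep a t < Suc n" using nabla_le[OF a] by (simp add: less_Suc_eq_le)
      then have "act (SK K) n m \<sigma> \<alpha> ! rv_rep a t = \<alpha> ! \<sigma> (rv_rep a t)"
        unfolding SK_act by (simp del: upt_Suc)
      then show "rv_rep (evaluate (n, act (SK K) n m \<sigma> \<alpha>, a)) t =
          rv_rep (evaluate (m, \<alpha>, Lone_map M {..m} \<sigma> a)) t"
        using t by simp
    qed
  qed (rule evaluate_in(1), fact cells, fact a, rule evaluate_in(1), fact \<alpha>, fact \<sigma>a)
qed

lemma continuous_map_evaluate:
  assumes xs: "xs \<in> cells (SK K) n"
  shows "continuous_map (nabla M n) weak_L (\<lambda>a. evaluate (n, xs, a))"
  unfolding weak_L_def
proof (rule continuous_map_into_weak_topology)
  show "set xs \<in> K" using xs by (simp add: SK_cells)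
  have "continuous_map (nabla M n) L.mtopology (\<lambda>a. evaluate (n, xs, a))"
    unfolding nabla_def
    by (intro Metric_space.continuous_map_nonexpansive Metric_space_nabla Metric_space_Lset)
      (auto intro: evaluate_in(1)[OF xs] evaluate_dist[OF xs])
  then show "continuous_map (nabla M n) (piece (set xs)) (\<lambda>a. evaluate (n, xs, a))"
    using evaluate_in(2)[OF xs] by (auto simp: piece_def continuous_map_in_subtopology complex_L_eq)
qed

lemma continuous_map_coordinates:
  assumes "xs \<in> cells (SK K) n"
  shows "continuous_map (piece F) (nabla M n) (coordinates n xs)"
  unfolding piece_def complex_L_eq nabla_def
  by (intro continuous_map_from_subtopology L.continuous_map_nonexpansive Metric_space_nabla)
    (auto intro: coordinates_in[OF assms] coordinates_dist[OF assms])

lemma top_cell_sum: "topspace (cell_sum M F) = (SIGMA n:UNIV. cells F n \<times> Lone M {..n})"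
  by (rule topspace_cell_sum) unfold_locales

lemma quotient_map_evaluate:
  assumes cells: "\<And>n. cells F n \<subseteq> cells (SK K) n"
    and dist: "\<And>n xs. xs \<in> cells (SK K) n \<Longrightarrow> distinct xs \<Longrightarrow> xs \<in> cells F n"
  shows "quotient_map (cell_sum M F) weak_L evaluate"
  unfolding quotient_map_def
proof (intro conjI allI impI)
  have face: "sorted_list_of_set G \<in> cells F (card G - 1)" if "G \<in> K" for G
    using dist face_cell[OF that] by blast
  show "evaluate ` topspace (cell_sum M F) = topspace weak_L"
  proof safe
    fix n xs a assume "(n, xs, a) \<in> topspace (cell_sum M F)"
    then show "evaluate (n, xs, a) \<in> topspace weak_L"
      using subsetD[OF cells] evaluate_in(1) by (auto simp: top_cell_sum)
  next
    fix A assume "A \<in> topspace weak_L"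
    then have A: "A \<in> Lset" "support A \<in> K" by (auto simp: Lset_iff)
    let ?n = "card (support A) - 1" and ?xs = "sorted_list_of_set (support A)"
    have "evaluate (?n, ?xs, coordinates ?n ?xs A) = A"
      using face_cell[OF A(2)] A(1) by (intro evaluate_coordinates) auto
    moreover have "(?n, ?xs, coordinates ?n ?xs A) \<in> topspace (cell_sum M F)"
      using face[OF A(2)] coordinates_in[OF face_cell(1)[OF A(2)] A(1)] by (simp add: top_cell_sum)
    ultimately show "A \<in> evaluate ` topspace (cell_sum M F)" by (metis imageI)
  qed
  fix U assume U: "U \<subseteq> topspace weak_L"
  let ?W = "{x \<in> topspace (cell_sum M F). evaluate x \<in> U}"
  have slice: "{a. (n, xs, a) \<in> ?W} = {a \<in> topspace (nabla M n). evaluate (n, xs, a) \<in> U}"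
    if "xs \<in> cells F n" for n xs
    using that by (auto simp: top_cell_sum)
  show "openin (cell_sum M F) ?W = openin weak_L U"
  proof
    assume "openin weak_L U"
    then have "openin (nabla M n) {a. (n, xs, a) \<in> ?W}" if "xs \<in> cells F n" for n xs
      unfolding slice[OF that]
      using that cells by (intro openin_continuous_map_preimage[OF continuous_map_evaluate]) auto
    then show "openin (cell_sum M F) ?W" by (auto simp: openin_cell_sum)
  next
    assume W: "openin (cell_sum M F) ?W"
    have "openin (piece G) (U \<inter> topspace (piece G))" if G: "G \<in> K" for G
    proof -
      let ?n = "card G - 1" and ?xs = "sorted_list_of_set G"
      have "openin (nabla M ?n) {a. (?n, ?xs, a) \<in> ?W}"
        using W face[OF G] by (simp only: openin_cell_sum)
      then have "openin (piece G) {A \<in> topspace (piece G).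
          coordinates ?n ?xs A \<in> {a \<in> topspace (nabla M ?n). evaluate (?n, ?xs, a) \<in> U}}"
        unfolding slice[OF face[OF G]]
        by (rule openin_continuous_map_preimage[OF continuous_map_coordinates[OF face_cell(1)[OF G]]])
      also have "{A \<in> topspace (piece G).
          coordinates ?n ?xs A \<in> {a \<in> topspace (nabla M ?n). evaluate (?n, ?xs, a) \<in> U}} =
          U \<inter> topspace (piece G)"
        using face_cell[OF G] coordinates_in[OF face_cell(1)[OF G]]
          evaluate_coordinates[OF face_cell(1)[OF G]] by auto
      finally show ?thesis .
    qed
    then show "openin weak_L U"
      using U unfolding weak_L_def openin_weak_topology topspace_weak_topology by blast
  qed
qed

text \<open>
  Degenerate cells may be present, provided that the morphisms which collapse them are present
  as well; the last assumption provides these and the inclusions of faces.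
\<close>
lemma presheaf_L_homeomorphic_weak_L:
  assumes presheaf: "presheaf_on Hom F"
    and cells: "\<And>n. cells F n \<subseteq> cells (SK K) n"
    and dist: "\<And>n xs. xs \<in> cells (SK K) n \<Longrightarrow> distinct xs \<Longrightarrow> xs \<in> cells F n"
    and Delta: "\<And>n m. Hom n m \<subseteq> Delta_hom n m"
    and act: "\<And>n m \<sigma> \<alpha>. \<sigma> \<in> Hom n m \<Longrightarrow> act F n m \<sigma> \<alpha> = act (SK K) n m \<sigma> \<alpha>"
    and Hom: "\<And>n m xs ys. xs \<in> cells F n \<Longrightarrow> ys \<in> cells (SK K) m \<Longrightarrow> distinct ys \<Longrightarrow>
      set xs \<subseteq> set ys \<Longrightarrow> reindex xs ys \<in> Hom n m"
  shows "presheaf_L Hom M F homeomorphic_space weak_L"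
  unfolding presheaf_L_def
proof (rule quotient_space_homeomorphic[OF equiv_generated_equiv quotient_map_evaluate[OF cells dist]])
  let ?A = "topspace (cell_sum M F)" and ?R = "glue_rel Hom M F"
  let ?E = "generated_equiv ?A ?R"
  have act_cells: "act F n m \<sigma> \<alpha> \<in> cells F n" if "\<sigma> \<in> Hom n m" "\<alpha> \<in> cells F m" for n m \<sigma> \<alpha>
    using presheaf[unfolded presheaf_on_def, THEN conjunct1, rule_format, OF that(1)] that(2)
    by (rule funcset_mem)
  let ?ker = "{(x, y). x \<in> ?A \<and> y \<in> ?A \<and> evaluate x = evaluate y}"
  have R: "?R \<subseteq> ?ker"
  proof
    fix z assume "z \<in> ?R"
    then obtain n m \<sigma> \<alpha> a where z: "z = ((n, act F n m \<sigma> \<alpha>, a), (m, \<alpha>, Lone_map M {..m} \<sigma> a))"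
      "\<sigma> \<in> Hom n m" "\<alpha> \<in> cells F m" "a \<in> Lone M {..n}"
      unfolding glue_rel_def by blast
    have "\<sigma> \<in> Delta_hom n m" "\<alpha> \<in> cells (SK K) m" using z(2,3) Delta cells by blast+
    from glue_evaluate[OF this z(4)] act_cells[OF z(2,3)]
    show "z \<in> ?ker" using z by (simp add: top_cell_sum act)
  qed
  have "equiv ?A ?ker"
    by (rule equivI) (auto simp: refl_on_def sym_def trans_def)
  then have E_ker: "?E \<subseteq> ?ker" using R by (rule generated_equiv_least)
  have R_E: "?R \<subseteq> ?E" using R by (intro generated_equiv_superset) auto
  \<comment> \<open>A point is glued to the one on the cell listing all values of the random variable, which is
    determined by the random variable: first remove repetitions, then superfluous vertices.\<close>
  have canonical: "((n, xs, a), (card G - 1, sorted_list_of_set G,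
      coordinates (card G - 1) (sorted_list_of_set G) (evaluate (n, xs, a)))) \<in> ?E"
    if xs: "xs \<in> cells F n" and a: "a \<in> Lone M {..n}" and G: "G = support (evaluate (n, xs, a))"
    for n xs a G
  proof -
    let ?B = "evaluate (n, xs, a)"
    let ?ys = "sorted_list_of_set (set xs)" and ?m = "card (set xs) - 1"
    let ?zs = "sorted_list_of_set G" and ?k = "card G - 1"
    let ?c = "coordinates ?k ?zs ?B"
    have xsK: "xs \<in> cells (SK K) n" using xs cells by blast
    then have "set xs \<in> K" by (simp add: SK_cells)
    note ys = face_cell[OF this]
    note B = evaluate_in[OF xsK a]
    have "G \<in> K" using B(1) G by (simp add: Lset_iff)
    note zs = face_cell[OF this]
    have ysF: "?ys \<in> cells F ?m" and zsF: "?zs \<in> cells F ?k" using dist ys zs by blast+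
    have step: "((n', xs', a'), (?m, ?ys, Lone_map M {..?m} (reindex xs' ?ys) a')) \<in> ?R"
      if "xs' \<in> cells F n'" "set xs' \<subseteq> set xs" "a' \<in> Lone M {..n'}" for n' xs' a'
    proof -
      have "reindex xs' ?ys \<in> Hom n' ?m" using that ys by (intro Hom) auto
      moreover from this have "act F n' ?m (reindex xs' ?ys) ?ys = xs'"
        using that cells ys by (subst act) (auto intro!: act_reindex)
      ultimately show ?thesis using that(3) ysF unfolding glue_rel_def by force
    qed
    have 1: "((n, xs, a), (?m, ?ys, Lone_map M {..?m} (reindex xs ?ys) a)) \<in> ?R"
      by (rule step[OF xs _ a]) simp
    have c: "?c \<in> Lone M {..?k}" by (rule coordinates_in[OF zs(1) B(1)])
    have 2: "((?k, ?zs, ?c), (?m, ?ys, Lone_map M {..?m} (reindex ?zs ?ys) ?c)) \<in> ?R"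
      by (rule step[OF zsF _ c]) (use zs(3) B(2) G in auto)
    have "evaluate (?k, ?zs, ?c) = ?B"
      using zs G by (intro evaluate_coordinates B) auto
    then have "Lone_map M {..?m} (reindex xs ?ys) a = Lone_map M {..?m} (reindex ?zs ?ys) ?c"
      using subsetD[OF R 1] subsetD[OF R 2]
      by (intro evaluate_inj[OF ys(1,2)]) (auto simp: top_cell_sum)
    then show ?thesis
      using subsetD[OF R_E 1] subsetD[OF R_E 2] equiv_generated_equiv[of ?A ?R]
      by (auto simp: equiv_def dest: symD transD)
  qed
  fix x y assume "x \<in> ?A" "y \<in> ?A"
  then obtain n xs a m ys b where x: "x = (n, xs, a)" "xs \<in> cells F n" "a \<in> Lone M {..n}"
    and y: "y = (m, ys, b)" "ys \<in> cells F m" "b \<in> Lone M {..m}"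
    by (auto simp: top_cell_sum)
  show "(x, y) \<in> ?E \<longleftrightarrow> evaluate x = evaluate y"
  proof
    assume "(x, y) \<in> ?E"
    then show "evaluate x = evaluate y" using E_ker by blast
  next
    assume eq: "evaluate x = evaluate y"
    have "(x, y) \<in> ?E" if "(x, z) \<in> ?E" "(y, z) \<in> ?E" for z
      using that equiv_generated_equiv[of ?A ?R] by (auto simp: equiv_def dest: symD transD)
    from this[OF canonical[OF x(2,3) refl, folded x(1)]] canonical[OF y(2,3) refl, folded y(1)]
    show "(x, y) \<in> ?E" by (simp add: eq)
  qed
qed

lemma simplicial_L_homeomorphic: "simplicial_L M (SK K) homeomorphic_space weak_L"
  unfolding simplicial_L_def
  by (rule presheaf_L_homeomorphic_weak_L[OF simplicial_set_SK[OF complex]])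
    (auto intro: reindex_Delta)

lemma presimplicial_L_homeomorphic: "presimplicial_L M (MK K) homeomorphic_space weak_L"
  unfolding presimplicial_L_def
proof (rule presheaf_L_homeomorphic_weak_L[OF presimplicial_set_MK[OF complex]])
  show "act (MK K) n m \<sigma> \<alpha> = act (SK K) n m \<sigma> \<alpha>" if "\<sigma> \<in> Inj_hom n m" for n m \<sigma> \<alpha>
    using that by (simp add: MK_def restrict_to_Inj_def)
  show "reindex xs ys \<in> Inj_hom n m"
    if "xs \<in> cells (MK K) n" "ys \<in> cells (SK K) m" "distinct ys" "set xs \<subseteq> set ys" for n m xs ys
    using that by (intro reindex_Inj) (auto simp: MK_def)
qed (auto simp: MK_def Inj_hom_def)

end

theorem theorem1p4:
  fixes M :: "'w measure" and S :: "'s::linorder set" and K :: "'s set set"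
  assumes "prob_space M" and "complete_measure M" and "atomless M"
    and "simplicial_complex_over S K"
  shows "simplicial_L M (SK K) homeomorphic_space presimplicial_L M (MK K) \<and>
    simplicial_L M (SK K) homotopy_equivalent_space complex_L M S K \<and>
    complex_L M S K homotopy_equivalent_space geometric_realization K \<and>
    simplicial_L M (SK K) homotopy_equivalent_space geometric_realization K"
proof -
  interpret prob_space M by fact
  obtain T :: "real \<Rightarrow> 'w set" where
    T: "\<And>t. T t \<in> sets M" "\<And>s t. s \<le> t \<Longrightarrow> T s \<subseteq> T t" "T 0 = {}" "T 1 = space M"
      "\<And>t. 0 \<le> t \<Longrightarrow> t \<le> 1 \<Longrightarrow> prob (T t) = t"
    using ex_nested_events[OF \<open>atomless M\<close>] by blast
  interpret random_simplices M T S K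
    using assms T by (simp add: random_simplices_def random_simplices_axioms_def complete_prob_space_def)
  have "simplicial_L M (SK K) homotopy_equivalent_space geometric_realization K"
    using homeomorphic_imp_homotopy_equivalent_space[OF simplicial_L_homeomorphic]
      weak_L_homotopy_equivalent homotopy_eqv_trans by blast
  moreover have "simplicial_L M (SK K) homeomorphic_space presimplicial_L M (MK K)"
    using simplicial_L_homeomorphic presimplicial_L_homeomorphic homeomorphic_space_trans
      homeomorphic_space_sym by blast
  ultimately show ?thesis
    using complex_L_homotopy_equivalent homotopy_eqv_trans homotopy_equivalent_space_sym
    by blast
qed

end
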